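(* Let $\mathcal{A}$ be the abelian category of all small $R$-modules, where $R=\mathbb{Z}[I]$ is the polynomial ring freely generated by the class $I$ of all small ordinals, and let $\mathbb{Z}\in\mathcal{A}$ be the trivial $R$-module. Then there is a proper class of morphisms $\mathbb{Z}\to\Sigma\mathbb{Z}$ in the derived category $\mathbf{D}(\mathcal{A})$; that is, $\operatorname{Hom}_{\mathbf{D}(\mathcal{A})}(\mathbb{Z},\Sigma\mathbb{Z})$ is not a small set.
   Context: Foundations are those of Mac Lane (Categories for the Working Mathematician, I.6): a universe $U$ is fixed, a set is small if it is an element of $U$, and classes are subsets of $U$. To say that there is a proper class of morphisms between two objects means that the collection of these morphisms is not small, i.e. it is not in bijection with any small set. Let $I$ be the class of all small ordinals and let $R=\mathbb{Z}[I]$ be the (commutative) polynomial ring over $\mathbb{Z}$ freely generated by $I$. The category $\mathcal{A}$ is the abelian category of all small $R$-modules: an object is a small abelian group $M$ together with group endomorphisms $\varphi_i\colon M\to M$ for every $i\in I$, such that all the $\varphi_i$ commute with one another; morphisms are the $R$-module homomorphisms, i.e. the group homomorphisms commuting with all $\varphi_i$. The trivial $R$-module $\mathbb{Z}\in\mathcal{A}$ is the additive group of integers with all $\varphi_i=0$. $\mathbf{K}(\mathcal{A})$ denotes the homotopy category of (unbounded) chain complexes in $\mathcal{A}$, with morphisms the chain homotopy classes of chain maps, and with its usual triangulated structure with suspension $\Sigma$. $\mathbf{A}(\mathcal{A})\subset\mathbf{K}(\mathcal{A})$ denotes the full triangulated subcategory of acyclic complexes. The derived category is the Verdier quotient $\mathbf{D}(\mathcal{A})=\mathbf{K}(\mathcal{A})/\mathbf{A}(\mathcal{A})$.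 Each $R$-module is viewed as a chain complex concentrated in degree zero. *)

theory Defs
  imports "HOL-Algebra.Group" "HOL-Library.Nat_Bijection"
begin

section \<open>The universe\<close>

text \<open>
  A type of this class is a universe in the sense of Mac Lane: its elements are the small sets,
  \<open>elts x\<close> is the class of members of the small set \<open>x\<close>, and a class is a set over the type.
  Transitivity of the universe is built in, since the members of a small set are again elements of
  the type. The power set of a small set contains \<^emph>\<open>all\<close> its subsets (axioms \<open>subset_small\<close> and
  \<open>power_small\<close>), and replacement holds for arbitrary functions; products and ordered
  pairs then come from pairing.
\<close>

class universe =
  fixes elts :: "'a \<Rightarrow> 'a set"
  assumes elts_inject: "elts x = elts y \<Longrightarrow> x = y"
    and elts_wf: "wf {(x, y). x \<in> elts y}"
    and subset_small: "S \<subseteq> elts x \<Longrightarrow> \<exists>z. elts z = S"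
    and pair_small: "\<exists>z. elts z = {x, y}"
    and union_small: "\<exists>z. elts z = (\<Union>y\<in>elts x. elts y)"
    and power_small: "\<exists>z. elts z = {y. elts y \<subseteq> elts x}"
    and infinity: "\<exists>w. (\<exists>z\<in>elts w. elts z = {}) \<and>
                       (\<forall>x\<in>elts w. \<exists>y\<in>elts w. elts y = insert x (elts x))"
    and replacement: "\<exists>z. elts z = f ` elts x"

text \<open>The small set with a given class of members; only meaningful if there is one.\<close>

definition vset :: "'u::universe set \<Rightarrow> 'u" where
  "vset S = (THE z. elts z = S)"

definition opair :: "'u::universe \<Rightarrow> 'u \<Rightarrow> 'u" where
  "opair x y = vset {vset {x}, vset {x, y}}"

definition ofst :: "'u::universe \<Rightarrow> 'u" where
  "ofst p = (THE x. \<exists>y. p = opair x y)"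

definition osnd :: "'u::universe \<Rightarrow> 'u" where
  "osnd p = (THE y. \<exists>x. p = opair x y)"

fun vnat :: "nat \<Rightarrow> 'u::universe" where
  "vnat 0 = vset {}"
| "vnat (Suc n) = vset (insert (vnat n) (elts (vnat n)))"

text \<open>The class of small ordinals: transitive small sets well-ordered by membership.\<close>

definition ordinals :: "'u::universe set" where
  "ordinals = {a. (\<forall>x\<in>elts a. elts x \<subseteq> elts a) \<and>
     well_order_on (elts a) {(x, y). x \<in> elts a \<and> y \<in> elts a \<and> (x = y \<or> x \<in> elts y)}}"


section \<open>Small modules over the polynomial ring on the class of small ordinals\<close>

text \<open>
  An abelian group is a commutative group of HOL-Algebra, so its addition, zero and negation are
  written \<open>\<otimes>\<close>, \<open>\<one>\<close> and \<open>inv\<close>. The field \<open>act\<close> gives the endomorphisms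
  \<open>\<phi>\<^sub>i\<close>; only its values at ordinals \<open>i\<close> and elements of the carrier matter.
\<close>

record 'u rmodule = "'u monoid" +
  act :: "'u \<Rightarrow> 'u \<Rightarrow> 'u"

definition rmodules :: "'u::universe rmodule set" where
  "rmodules = {M. comm_group M \<and> (\<exists>m. elts m = carrier M) \<and>
     (\<forall>i\<in>ordinals. act M i \<in> hom M M) \<and>
     (\<forall>i\<in>ordinals. \<forall>j\<in>ordinals. \<forall>x\<in>carrier M. act M i (act M j x) = act M j (act M i x))}"

definition rhom :: "'u::universe rmodule \<Rightarrow> 'u rmodule \<Rightarrow> ('u \<Rightarrow> 'u) set" where
  "rhom M N = {f \<in> hom M N. f \<in> extensional (carrier M) \<and>
     (\<forall>i\<in>ordinals. \<forall>x\<in>carrier M. f (act M i x) = act N i (f x))}"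

definition zero_rmodule :: "'u::universe rmodule" where
  "zero_rmodule = \<lparr>carrier = {vset {}}, monoid.mult = (\<lambda>x y. vset {}), one = vset {},
     act = (\<lambda>i x. vset {})\<rparr>"

text \<open>The direct sum of two modules, carried by Kuratowski pairs.\<close>

definition dsum :: "'u::universe rmodule \<Rightarrow> 'u rmodule \<Rightarrow> 'u rmodule" where
  "dsum M N = \<lparr>carrier = {opair x y | x y. x \<in> carrier M \<and> y \<in> carrier N},
     monoid.mult = (\<lambda>p q. opair (ofst p \<otimes>\<^bsub>M\<^esub> ofst q) (osnd p \<otimes>\<^bsub>N\<^esub> osnd q)),
     one = opair \<one>\<^bsub>M\<^esub> \<one>\<^bsub>N\<^esub>,
     act = (\<lambda>i p. opair (act M i (ofst p)) (act N i (osnd p)))\<rparr>"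

text \<open>
  The trivial module of integers. The integer \<open>k\<close> is represented in the universe by the finite
  von Neumann ordinal numbered \<open>int_encode k\<close>, and the group structure is transported
  along this bijection.
\<close>

definition vint :: "int \<Rightarrow> 'u::universe" where
  "vint k = vnat (int_encode k)"

definition vint_inv :: "'u::universe \<Rightarrow> int" where
  "vint_inv = inv_into UNIV vint"

definition trivial_Z :: "'u::universe rmodule" where
  "trivial_Z = \<lparr>carrier = range vint, monoid.mult = (\<lambda>x y. vint (vint_inv x + vint_inv y)),
     one = vint 0, act = (\<lambda>i x. vint 0)\<rparr>"


section \<open>Unbounded chain complexes and chain homotopy\<close>

text \<open>Homological grading: differentials lower the degree by one.\<close>

record 'u chain_complex =
  Obj :: "int \<Rightarrow> 'u rmodule"
  Diff :: "int \<Rightarrow> 'u \<Rightarrow> 'u"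

definition chain_complexes :: "'u::universe chain_complex set" where
  "chain_complexes = {X. (\<forall>n. Obj X n \<in> rmodules) \<and>
     (\<forall>n. Diff X n \<in> rhom (Obj X n) (Obj X (n - 1))) \<and>
     (\<forall>n. \<forall>x\<in>carrier (Obj X n). Diff X (n - 1) (Diff X n x) = \<one>\<^bsub>Obj X (n - 2)\<^esub>)}"

definition acyclic_complexes :: "'u::universe chain_complex set" where
  "acyclic_complexes = {X \<in> chain_complexes. \<forall>n. \<forall>x\<in>carrier (Obj X n).
     Diff X n x = \<one>\<^bsub>Obj X (n - 1)\<^esub> \<longrightarrow> (\<exists>y\<in>carrier (Obj X (n + 1)). Diff X (n + 1) y = x)}"

definition chain_maps ::
  "'u::universe chain_complex \<Rightarrow> 'u chain_complex \<Rightarrow> (int \<Rightarrow> 'u \<Rightarrow> 'u) set" where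
  "chain_maps X Y = {f. \<forall>n. f n \<in> rhom (Obj X n) (Obj Y n) \<and>
     (\<forall>x\<in>carrier (Obj X n). Diff Y n (f n x) = f (n - 1) (Diff X n x))}"

definition chain_id :: "'u::universe chain_complex \<Rightarrow> int \<Rightarrow> 'u \<Rightarrow> 'u" where
  "chain_id X n = (\<lambda>x\<in>carrier (Obj X n). x)"

definition chain_comp ::
  "'u::universe chain_complex \<Rightarrow> (int \<Rightarrow> 'u \<Rightarrow> 'u) \<Rightarrow> (int \<Rightarrow> 'u \<Rightarrow> 'u) \<Rightarrow> int \<Rightarrow> 'u \<Rightarrow> 'u" where
  "chain_comp X g f n = compose (carrier (Obj X n)) (g n) (f n)"

text \<open>Chain homotopy, \<open>f - g = d h + h d\<close>, as an equivalence relation on chain maps.\<close>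

definition homotopy_rel ::
  "'u::universe chain_complex \<Rightarrow> 'u chain_complex \<Rightarrow> (int \<Rightarrow> 'u \<Rightarrow> 'u) rel" where
  "homotopy_rel X Y = {(f, g). f \<in> chain_maps X Y \<and> g \<in> chain_maps X Y \<and>
     (\<exists>h. \<forall>n. h n \<in> rhom (Obj X n) (Obj Y (n + 1)) \<and>
       (\<forall>x\<in>carrier (Obj X n).
          f n x \<otimes>\<^bsub>Obj Y n\<^esub> inv\<^bsub>Obj Y n\<^esub> (g n x) =
          Diff Y (n + 1) (h n x) \<otimes>\<^bsub>Obj Y n\<^esub> h (n - 1) (Diff X n x)))}"

definition in_degree_zero :: "'u::universe rmodule \<Rightarrow> 'u chain_complex" where
  "in_degree_zero M = (let ob = (\<lambda>n. if n = 0 then M else zero_rmodule) in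
     \<lparr>Obj = ob, Diff = (\<lambda>n. \<lambda>x\<in>carrier (ob n). \<one>\<^bsub>ob (n - 1)\<^esub>)\<rparr>)"

definition suspension :: "'u::universe chain_complex \<Rightarrow> 'u chain_complex" where
  "suspension X = \<lparr>Obj = (\<lambda>n. Obj X (n - 1)),
     Diff = (\<lambda>n. \<lambda>x\<in>carrier (Obj X (n - 1)). inv\<^bsub>Obj X (n - 2)\<^esub> (Diff X (n - 1) x))\<rparr>"

text \<open>
  The mapping cone: \<open>X\<^sub>n\<^sub>-\<^sub>1 \<oplus> Y\<^sub>n\<close> in degree \<open>n\<close>, with differential
  \<open>(x, y) \<mapsto> (- d x, f x + d y)\<close>, together with the inclusion of \<open>Y\<close> and the projection
  onto the suspension of \<open>X\<close>.
\<close>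

definition cone ::
  "'u::universe chain_complex \<Rightarrow> 'u chain_complex \<Rightarrow> (int \<Rightarrow> 'u \<Rightarrow> 'u) \<Rightarrow> 'u chain_complex" where
  "cone X Y f = \<lparr>Obj = (\<lambda>n. dsum (Obj X (n - 1)) (Obj Y n)),
     Diff = (\<lambda>n. \<lambda>p\<in>carrier (dsum (Obj X (n - 1)) (Obj Y n)).
       opair (inv\<^bsub>Obj X (n - 2)\<^esub> (Diff X (n - 1) (ofst p)))
             (f (n - 1) (ofst p) \<otimes>\<^bsub>Obj Y (n - 1)\<^esub> Diff Y n (osnd p)))\<rparr>"

definition cone_in ::
  "'u::universe chain_complex \<Rightarrow> 'u chain_complex \<Rightarrow> int \<Rightarrow> 'u \<Rightarrow> 'u" where
  "cone_in X Y n = (\<lambda>y\<in>carrier (Obj Y n). opair \<one>\<^bsub>Obj X (n - 1)\<^esub> y)"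

definition cone_out ::
  "'u::universe chain_complex \<Rightarrow> 'u chain_complex \<Rightarrow> int \<Rightarrow> 'u \<Rightarrow> 'u" where
  "cone_out X Y n = (\<lambda>p\<in>carrier (dsum (Obj X (n - 1)) (Obj Y n)). ofst p)"


section \<open>Triangulated structure and Verdier quotient\<close>

text \<open>
  The structure of a category, and of a category with suspension and a class of distinguished
  triangles. These records carry data only. \<open>Comp C X Y Z g f\<close> is the composite of
  \<open>f : X \<rightarrow> Y\<close> and \<open>g : Y \<rightarrow> Z\<close>, and \<open>(X, Y, Z, f, g, h)\<close> stands for the triangle
  \<open>X \<rightarrow> Y \<rightarrow> Z \<rightarrow> Susp X\<close>.
\<close>

record ('o, 'm) cat =
  Ob :: "'o set"
  Hom :: "'o \<Rightarrow> 'o \<Rightarrow> 'm set"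
  Id :: "'o \<Rightarrow> 'm"
  Comp :: "'o \<Rightarrow> 'o \<Rightarrow> 'o \<Rightarrow> 'm \<Rightarrow> 'm \<Rightarrow> 'm"

type_synonym ('o, 'm) triangle = "'o \<times> 'o \<times> 'o \<times> 'm \<times> 'm \<times> 'm"

record ('o, 'm) tricat = "('o, 'm) cat" +
  Susp :: "'o \<Rightarrow> 'o"
  SuspMor :: "'o \<Rightarrow> 'o \<Rightarrow> 'm \<Rightarrow> 'm"
  Dist :: "('o, 'm) triangle set"

definition isos :: "('o, 'm, 'e) cat_scheme \<Rightarrow> 'o \<Rightarrow> 'o \<Rightarrow> 'm set" where
  "isos C X Y = {a \<in> Hom C X Y. \<exists>b\<in>Hom C Y X. Comp C X Y X b a = Id C X \<and> Comp C Y X Y a b = Id C Y}"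

text \<open>The morphisms inverted by the Verdier quotient by the full subcategory on \<open>S\<close>.\<close>

definition verdier_mor :: "('o, 'm) tricat \<Rightarrow> 'o set \<Rightarrow> 'o \<Rightarrow> 'o \<Rightarrow> 'm set" where
  "verdier_mor C S X Y = {f \<in> Hom C X Y. \<exists>Z g h. Z \<in> S \<and> (X, Y, Z, f, g, h) \<in> Dist C}"

text \<open>A roof \<open>(W, s, f)\<close> from \<open>X\<close> to \<open>Y\<close> is \<open>X \<leftarrow> W \<rightarrow> Y\<close> and represents \<open>f s\<^sup>-\<^sup>1\<close>.\<close>

definition roofs :: "('o, 'm) tricat \<Rightarrow> 'o set \<Rightarrow> 'o \<Rightarrow> 'o \<Rightarrow> ('o \<times> 'm \<times> 'm) set" where
  "roofs C S X Y = {(W, s, f). W \<in> Ob C \<and> s \<in> verdier_mor C S W X \<and> f \<in> Hom C W Y}"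

definition roof_rel :: "('o, 'm) tricat \<Rightarrow> 'o set \<Rightarrow> 'o \<Rightarrow> 'o \<Rightarrow> ('o \<times> 'm \<times> 'm) rel" where
  "roof_rel C S X Y = {((W, s, f), (W', s', f')).
     (W, s, f) \<in> roofs C S X Y \<and> (W', s', f') \<in> roofs C S X Y \<and>
     (\<exists>(V, t, g) \<in> roofs C S X Y. \<exists>u\<in>Hom C V W. \<exists>u'\<in>Hom C V W'.
        Comp C V W X s u = t \<and> Comp C V W' X s' u' = t \<and>
        Comp C V W Y f u = g \<and> Comp C V W' Y f' u' = g)}"

text \<open>
  Roofs \<open>(W, s, f)\<close> and \<open>(W', s', f')\<close> are composed by completing \<open>W \<rightarrow> Y \<leftarrow> W'\<close> to a commutative
  square with an inverted morphism \<open>V \<rightarrow> W\<close>.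
\<close>

definition verdier_quotient ::
  "('o, 'm) tricat \<Rightarrow> 'o set \<Rightarrow> ('o, ('o \<times> 'm \<times> 'm) set) cat" where
  "verdier_quotient C S = \<lparr>
     Ob = Ob C,
     Hom = (\<lambda>X Y. roofs C S X Y // roof_rel C S X Y),
     Id = (\<lambda>X. roof_rel C S X X `` {(X, Id C X, Id C X)}),
     Comp = (\<lambda>X Y Z b a. \<Union> {roof_rel C S X Z `` {(V, Comp C V W X s u, Comp C V W' Z f' u')} |
        W s f W' s' f' V u u'. (W, s, f) \<in> a \<and> (W', s', f') \<in> b \<and> V \<in> Ob C \<and>
          u \<in> verdier_mor C S V W \<and> u' \<in> Hom C V W' \<and>
          Comp C V W Y f u = Comp C V W' Y s' u'})\<rparr>"


section \<open>The homotopy category and the derived category\<close>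

definition homotopy_cat :: "('u::universe chain_complex, (int \<Rightarrow> 'u \<Rightarrow> 'u) set) cat" where
  "homotopy_cat = \<lparr>
     Ob = chain_complexes,
     Hom = (\<lambda>X Y. chain_maps X Y // homotopy_rel X Y),
     Id = (\<lambda>X. homotopy_rel X X `` {chain_id X}),
     Comp = (\<lambda>X Y Z b a. \<Union>f\<in>a. \<Union>g\<in>b. homotopy_rel X Z `` {chain_comp X g f})\<rparr>"

definition susp_mor ::
  "'u::universe chain_complex \<Rightarrow> 'u chain_complex \<Rightarrow> (int \<Rightarrow> 'u \<Rightarrow> 'u) set \<Rightarrow> (int \<Rightarrow> 'u \<Rightarrow> 'u) set" where
  "susp_mor X Y a = (\<Union>f\<in>a. homotopy_rel (suspension X) (suspension Y) `` {\<lambda>n. f (n - 1)})"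

definition cone_triangles :: "('u::universe chain_complex, (int \<Rightarrow> 'u \<Rightarrow> 'u) set) triangle set" where
  "cone_triangles = {(X, Y, cone X Y f,
       homotopy_rel X Y `` {f},
       homotopy_rel Y (cone X Y f) `` {cone_in X Y},
       homotopy_rel (cone X Y f) (suspension X) `` {cone_out X Y}) | X Y f.
     X \<in> chain_complexes \<and> Y \<in> chain_complexes \<and> f \<in> chain_maps X Y}"

definition distinguished :: "('u::universe chain_complex, (int \<Rightarrow> 'u \<Rightarrow> 'u) set) triangle set" where
  "distinguished = {(X, Y, Z, f, g, h).
     X \<in> chain_complexes \<and> Y \<in> chain_complexes \<and> Z \<in> chain_complexes \<and>
     f \<in> Hom homotopy_cat X Y \<and> g \<in> Hom homotopy_cat Y Z \<and> h \<in> Hom homotopy_cat Z (suspension X) \<and>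
     (\<exists>(X', Y', Z', f', g', h') \<in> cone_triangles.
        \<exists>a\<in>isos homotopy_cat X X'. \<exists>b\<in>isos homotopy_cat Y Y'. \<exists>c\<in>isos homotopy_cat Z Z'.
          Comp homotopy_cat X Y Y' b f = Comp homotopy_cat X X' Y' f' a \<and>
          Comp homotopy_cat Y Z Z' c g = Comp homotopy_cat Y Y' Z' g' b \<and>
          Comp homotopy_cat Z (suspension X) (suspension X') (susp_mor X X' a) h =
          Comp homotopy_cat Z Z' (suspension X') h' c)}"

definition K_A :: "('u::universe chain_complex, (int \<Rightarrow> 'u \<Rightarrow> 'u) set) tricat" where
  "K_A = cat.extend homotopy_cat
     \<lparr>Susp = suspension, SuspMor = susp_mor, Dist = distinguished\<rparr>"

definition D_A ::
  "('u::universe chain_complex,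
    ('u chain_complex \<times> (int \<Rightarrow> 'u \<Rightarrow> 'u) set \<times> (int \<Rightarrow> 'u \<Rightarrow> 'u) set) set) cat" where
  "D_A = verdier_quotient K_A acyclic_complexes"

end

theory Submission
  imports Defs
begin

text \<open>
  The class of ordinals injects into the morphisms \<open>\<int> \<rightarrow> \<Sigma>\<int>\<close>. For an ordinal \<open>i\<close> let \<open>M\<^sub>i\<close> be
  \<open>\<int> \<oplus> \<int>\<close> with \<open>\<phi>\<^sub>i (a, b) = (0, a)\<close> and all other operators zero. It is an extension
  \<open>0 \<rightarrow> \<int> \<rightarrow> M\<^sub>i \<rightarrow> \<int> \<rightarrow> 0\<close>. The cone \<open>W\<^sub>i\<close> of \<open>\<int> \<rightarrow> M\<^sub>i\<close> is a two-term complex with a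
  quasi-isomorphism \<open>s\<^sub>i\<close> to \<open>\<int>\<close> and the canonical projection \<open>p\<^sub>i\<close> to \<open>\<Sigma>\<int>\<close>, so
  \<open>\<int> \<leftarrow> W\<^sub>i \<rightarrow> \<Sigma>\<int>\<close> is a roof: the class of the extension.

  Distinct ordinals give distinct classes (\<open>extension_roofs_distinct\<close>). If the roofs of \<open>i\<close> and \<open>j\<close>
  are equivalent, there are a complex \<open>V\<close>, a quasi-isomorphism \<open>t : V \<rightarrow> \<int>\<close>, and maps
  \<open>u : V \<rightarrow> W\<^sub>i\<close>, \<open>u' : V \<rightarrow> W\<^sub>j\<close> with \<open>s\<^sub>i u \<simeq> t \<simeq> s\<^sub>j u'\<close> and \<open>p\<^sub>i u \<simeq> p\<^sub>j u'\<close>. Choose a cycle \<open>v\<close> of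
  degree zero with \<open>t v = 1\<close>. As \<open>t (\<phi>\<^sub>i v) = \<phi>\<^sub>i 1 = 0\<close>, the cycle \<open>\<phi>\<^sub>i v\<close> is a boundary \<open>d w\<close>.
  The image of \<open>v\<close> in \<open>M\<^sub>k\<close> has the form \<open>(1, b)\<close>, and \<open>d\<close> on \<open>W\<^sub>k\<close> is the inclusion
  \<open>\<int> \<rightarrow> M\<^sub>k\<close>. Hence \<open>\<phi>\<^sub>i (1, b)\<close> determines the degree-one component of the image of \<open>w\<close>: it is 1 for
  \<open>k = i\<close> and 0 for \<open>k \<noteq> i\<close> (\<open>boundary_of_scaled_unit\<close>). A homotopy \<open>h\<close> from \<open>p\<^sub>j u'\<close> to \<open>p\<^sub>i u\<close>
  changes the value at \<open>w\<close> by \<open>h (d w) = \<phi>\<^sub>i (h v) = 0\<close>. So \<open>i = j\<close>.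

  The argument needs two bridges. Between Verdier's construction and elements: a morphism of the homotopy
  category is inverted exactly if it is bijective on homology (\<open>quasi_iso_inverted\<close>,
  \<open>inverted_quasi_iso\<close>), because the homology of a cone measures the failure of bijectivity. Between
  ordinals and size: a small set of morphisms would make the class of ordinals small by replacement,
  against the Burali-Forti argument (\<open>ordinals_not_small\<close>).
\<close>

section \<open>Small sets\<close>

lemma elts_vset: "elts z = S \<Longrightarrow> elts (vset S) = S"
  unfolding vset_def by (rule theI) (auto intro: elts_inject)

lemma elts_vset_subset: "S \<subseteq> elts x \<Longrightarrow> elts (vset S) = S"
  using subset_small elts_vset by metis

lemma elts_vset_empty [simp]: "elts (vset {}) = {}"
  by (rule elts_vset_subset) auto

lemma elts_vset_pair [simp]: "elts (vset {x, y}) = {x, y}"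
  using pair_small elts_vset by metis

lemma elts_vset_singleton [simp]: "elts (vset {x}) = {x}"
  using elts_vset_pair[of x x] by simp

lemma elts_vset_insert [simp]: "elts (vset (insert x (elts y))) = insert x (elts y)"
proof -
  obtain z where "elts z = (\<Union>w\<in>elts (vset {vset {x}, y}). elts w)"
    using union_small by blast
  then show ?thesis by (intro elts_vset[of z]) auto
qed

lemma elts_vset_image [simp]:
  fixes f :: "'u::universe \<Rightarrow> 'u"
  shows "elts (vset (f ` elts x)) = f ` elts x"
proof -
  obtain z where "elts z = f ` elts x" using replacement by blast
  then show ?thesis by (rule elts_vset)
qed

lemma opair_inject [simp]: "opair x y = opair x' y' \<longleftrightarrow> x = x' \<and> y = y'"
proof
  assume "opair x y = opair x' y'"
  then have "elts ` elts (opair x y) = elts ` elts (opair x' y')" by (rule arg_cong)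
  then have "{{x}, {x, y}} = {{x'}, {x', y'}}" unfolding opair_def by simp
  then show "x = x' \<and> y = y'" by (auto simp: doubleton_eq_iff)
qed simp

lemma ofst_opair [simp]: "ofst (opair x y) = x"
  unfolding ofst_def by auto

lemma osnd_opair [simp]: "osnd (opair x y) = y"
  unfolding osnd_def by auto

lemma small_product:
  fixes x y :: "'u::universe"
  shows "\<exists>z. elts z = {opair a b | a b. a \<in> elts x \<and> b \<in> elts y}"
proof -
  let ?row = "\<lambda>a. vset (opair a ` elts y)"
  obtain z where z: "elts z = (\<Union>w\<in>elts (vset (?row ` elts x)). elts w)"
    using union_small by blast
  have "elts z = {opair a b | a b. a \<in> elts x \<and> b \<in> elts y}"
    unfolding z elts_vset_image image_image UN_simps(10) by blast
  then show ?thesis by (rule exI)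
qed

lemma elts_irrefl [simp]: "x \<notin> elts x"
  using wf_not_refl[OF elts_wf, of x] by simp

lemma elts_asym: "x \<in> elts y \<Longrightarrow> y \<notin> elts x"
  using wf_asym[OF elts_wf, of x y] by simp

lemma vnat_less: "m < n \<Longrightarrow> vnat m \<in> elts (vnat n)"
  by (induction n) (auto simp: less_Suc_eq)

lemma inj_vnat: "inj vnat"
proof (rule injI)
  fix m n assume "(vnat m :: 'a) = vnat n"
  then show "m = n" by (metis elts_irrefl linorder_neqE_nat vnat_less)
qed

lemma vint_inv_vint [simp]: "vint_inv (vint k :: 'u::universe) = k"
proof -
  have "inj (vint :: int \<Rightarrow> 'u)"
    unfolding vint_def using inj_compose[OF inj_vnat inj_int_encode] by (simp add: comp_def)
  then show ?thesis unfolding vint_inv_def by simp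
qed

lemma vint_inject [simp]: "vint k = vint l \<longleftrightarrow> k = l"
  by (metis vint_inv_vint)

lemma small_range_vint: "\<exists>z. elts z = range (vint :: int \<Rightarrow> 'u::universe)"
proof -
  obtain w :: 'u where w: "(\<exists>z\<in>elts w. elts z = {}) \<and>
      (\<forall>x\<in>elts w. \<exists>y\<in>elts w. elts y = insert x (elts x))"
    using infinity ..
  have "vnat n \<in> elts w" for n
  proof (induction n)
    case 0
    obtain z where z: "z \<in> elts w" "elts z = {}" using w by blast
    then have "z = vnat 0" by (intro elts_inject) simp
    then show ?case using z by simp
  next
    case (Suc n)
    then obtain y where y: "y \<in> elts w" "elts y = insert (vnat n) (elts (vnat n))" using w by blast
    then have "y = vnat (Suc n)" by (intro elts_inject) simp
    then show ?case using y by simp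
  qed
  then show ?thesis by (intro subset_small[of _ w]) (auto simp: vint_def)
qed

section \<open>The class of ordinals is proper\<close>

lemma ordinal_transitive: "a \<in> ordinals \<Longrightarrow> x \<in> elts a \<Longrightarrow> elts x \<subseteq> elts a"
  unfolding ordinals_def by blast

text \<open>
  Well-foundedness and antisymmetry of membership come from the axiom of foundation, so an ordinal is
  described by transitivity of the set, transitivity of its elements (which is transitivity of the
  order), and comparability.
\<close>

lemma ordinals_iff:
  "a \<in> ordinals \<longleftrightarrow> (\<forall>x\<in>elts a. elts x \<subseteq> elts a) \<and> (\<forall>x\<in>elts a. \<forall>y\<in>elts x. elts y \<subseteq> elts x) \<and>
     (\<forall>x\<in>elts a. \<forall>y\<in>elts a. x = y \<or> x \<in> elts y \<or> y \<in> elts x)"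
  (is "_ \<longleftrightarrow> ?trans \<and> ?etrans \<and> ?total")
proof -
  let ?r = "{(x, y). x \<in> elts a \<and> y \<in> elts a \<and> (x = y \<or> x \<in> elts y)}"
  have wf: "wf (?r - Relation.Id)" by (rule wf_subset[OF elts_wf]) auto
  have antisym: "antisym ?r" using elts_asym by (intro antisymI) blast
  have refl: "refl_on (elts a) ?r" "?r \<subseteq> elts a \<times> elts a" by (auto simp: refl_on_def)
  have tot: "total_on (elts a) ?r \<longleftrightarrow> ?total" unfolding total_on_def by blast
  have tr: "trans ?r \<longleftrightarrow> ?etrans" if T: ?trans
  proof
    assume r: "trans ?r"
    show ?etrans
    proof (intro ballI subsetI)
      fix x y z assume A: "x \<in> elts a" "y \<in> elts x" "z \<in> elts y"
      then have "y \<in> elts a" "z \<in> elts a" using T by blast+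
      then have "(z, x) \<in> ?r" using A by (intro transD[OF r, of z y x]) auto
      then show "z \<in> elts x" using A elts_asym by auto
    qed
  next
    assume ?etrans
    then show "trans ?r" by (intro transI) blast
  qed
  have "a \<in> ordinals \<longleftrightarrow> ?trans \<and> trans ?r \<and> total_on (elts a) ?r"
    unfolding ordinals_def well_order_on_def linear_order_on_def partial_order_on_def
      preorder_on_def mem_Collect_eq
    by (simp only: wf antisym refl simp_thms)
  then show ?thesis unfolding tot using tr by satx
qed

lemma element_of_ordinal:
  assumes "a \<in> ordinals" "x \<in> elts a"
  shows "x \<in> ordinals"
proof -
  note a = assms(1)[unfolded ordinals_iff]
  have x: "elts x \<subseteq> elts a" using a assms(2) by blast
  moreover have "\<forall>y\<in>elts x. elts y \<subseteq> elts x" using a assms(2) by blast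
  moreover have "\<forall>y\<in>elts x. \<forall>z\<in>elts y. elts z \<subseteq> elts y" using a x by blast
  moreover have "\<forall>y\<in>elts x. \<forall>z\<in>elts x. y = z \<or> y \<in> elts z \<or> z \<in> elts y"
    using a x by (meson subsetD)
  ultimately show ?thesis unfolding ordinals_iff by simp
qed

text \<open>
  The membership-least element of \<open>b - a\<close> is \<open>a\<close> itself.
\<close>

lemma ordinal_proper_subset:
  assumes a: "\<And>x. x \<in> elts a \<Longrightarrow> elts x \<subseteq> elts a" and b: "b \<in> ordinals" and ab: "elts a \<subset> elts b"
  shows "a \<in> elts b"
proof -
  note b = b[unfolded ordinals_iff]
  obtain d where "d \<in> elts b - elts a" using ab by blast
  then obtain c where c': "c \<in> elts b - elts a"
    and min: "\<And>y. (y, c) \<in> {(x, y). x \<in> elts y} \<Longrightarrow> y \<notin> elts b - elts a"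
    by (rule wfE_min[OF elts_wf]) (rule that)
  from c' have c: "c \<in> elts b" "c \<notin> elts a" by auto
  have "elts c \<subseteq> elts b" using b c(1) by blast
  then have "elts c \<subseteq> elts a" using min by blast
  moreover have "elts a \<subseteq> elts c"
  proof
    fix d assume d: "d \<in> elts a"
    then have "d \<in> elts b" using ab by blast
    then have "d = c \<or> d \<in> elts c \<or> c \<in> elts d" using b c(1) by blast
    then show "d \<in> elts c" using d c(2) a by blast
  qed
  ultimately have "a = c" by (intro elts_inject) auto
  then show ?thesis using c(1) by simp
qed

text \<open>
  The intersection \<open>c\<close> of two ordinals is equal to, or an element of, each of them. It cannot be an
  element of both, since then \<open>c \<in> c\<close>.
\<close>

lemma ordinal_trichotomy:
  assumes a: "a \<in> ordinals" and b: "b \<in> ordinals"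
  shows "a = b \<or> a \<in> elts b \<or> b \<in> elts a"
proof -
  define c where "c = vset (elts a \<inter> elts b)"
  have c: "elts c = elts a \<inter> elts b" unfolding c_def by (rule elts_vset_subset) (rule Int_lower1)
  have tr: "elts x \<subseteq> elts c" if "x \<in> elts c" for x
    using that c a b ordinal_transitive[of a x] ordinal_transitive[of b x] by simp
  have "c = d \<or> c \<in> elts d" if d: "d \<in> ordinals" "elts c \<subseteq> elts d" for d
    using ordinal_proper_subset[OF tr d(1)] d(2) elts_inject[of c d] by (auto simp: psubset_eq)
  then have "c = a \<or> c \<in> elts a" "c = b \<or> c \<in> elts b"
    using a b c by simp_all
  moreover have "\<not> (c \<in> elts a \<and> c \<in> elts b)" using elts_irrefl[of c] c by blast
  ultimately show ?thesis by metis
qed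

text \<open>
  Burali-Forti: a small set of all ordinals would be an ordinal, hence an element of itself.
\<close>

lemma ordinals_not_small: "elts a \<noteq> ordinals"
proof
  assume a: "elts a = ordinals"
  have "\<forall>x\<in>ordinals. elts x \<subseteq> ordinals" using element_of_ordinal by blast
  moreover have "\<forall>x\<in>ordinals. \<forall>y\<in>elts x. elts y \<subseteq> elts x"
    using ordinal_transitive by blast
  ultimately have "a \<in> ordinals"
    unfolding ordinals_iff[of a] a using ordinal_trichotomy by blast
  then show False using a elts_irrefl by metis
qed

text \<open>
  Replacement applies to functions on the universe only, whereas \<open>H\<close> may live in another type. The
  bijection \<open>b\<close> moves the injection \<open>F\<close> into the small set \<open>s\<close>, and replacement along the
  inverse of the resulting injection makes the class of ordinals small.
\<close>

lemma no_small_set_of_representatives: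
  fixes s :: "'u::universe" and F :: "'u \<Rightarrow> 'b"
  assumes b: "bij_betw b (elts s) H" and F: "inj_on F ordinals" "F ` ordinals \<subseteq> H"
  shows False
proof -
  let ?G = "\<lambda>i. inv_into (elts s) b (F i)"
  have inv: "b (?G i) = F i" "?G i \<in> elts s" if "i \<in> ordinals" for i
    using that b F(2) by (auto simp: bij_betw_def f_inv_into_f inv_into_into)
  have "inj_on ?G ordinals" using F(1) inv(1) by (metis (no_types, lifting) inj_on_def)
  moreover have "elts (vset (?G ` ordinals)) = ?G ` ordinals"
    using inv(2) by (intro elts_vset_subset) auto
  ultimately have "elts (vset (inv_into ordinals ?G ` elts (vset (?G ` ordinals)))) = ordinals"
    by (subst elts_vset_image) simp
  then show False using ordinals_not_small by metis
qed

section \<open>Modules, complexes and chain maps\<close>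

lemma rmodule_comm_group: "M \<in> rmodules \<Longrightarrow> comm_group M"
  by (simp add: rmodules_def)

text \<open>
  Homomorphisms are extensional functions, so they are always presented as restrictions to the carrier.
\<close>

lemma rhomI:
  assumes M: "M \<in> rmodules" and "\<And>x. x \<in> carrier M \<Longrightarrow> f x \<in> carrier N"
    and "\<And>x y. x \<in> carrier M \<Longrightarrow> y \<in> carrier M \<Longrightarrow> f (x \<otimes>\<^bsub>M\<^esub> y) = f x \<otimes>\<^bsub>N\<^esub> f y"
    and "\<And>i x. i \<in> ordinals \<Longrightarrow> x \<in> carrier M \<Longrightarrow> f (act M i x) = act N i (f x)"
  shows "restrict f (carrier M) \<in> rhom M N"
proof -
  interpret comm_group M using M by (simp add: rmodules_def)
  have "act M i x \<in> carrier M" if "i \<in> ordinals" "x \<in> carrier M" for i x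
    using M that by (auto simp: rmodules_def hom_def)
  then show ?thesis using assms by (auto simp: rhom_def hom_def)
qed

lemma
  assumes "f \<in> rhom M N"
  shows rhom_closed: "x \<in> carrier M \<Longrightarrow> f x \<in> carrier N"
    and rhom_mult: "x \<in> carrier M \<Longrightarrow> y \<in> carrier M \<Longrightarrow> f (x \<otimes>\<^bsub>M\<^esub> y) = f x \<otimes>\<^bsub>N\<^esub> f y"
    and rhom_act: "i \<in> ordinals \<Longrightarrow> x \<in> carrier M \<Longrightarrow> f (act M i x) = act N i (f x)"
    and rhom_extensional: "f \<in> extensional (carrier M)"
  using assms by (auto simp: rhom_def hom_def)

lemma
  assumes "f \<in> rhom M N" "M \<in> rmodules" "N \<in> rmodules"
  shows rhom_one: "f \<one>\<^bsub>M\<^esub> = \<one>\<^bsub>N\<^esub>"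
    and rhom_inv: "x \<in> carrier M \<Longrightarrow> f (inv\<^bsub>M\<^esub> x) = inv\<^bsub>N\<^esub> (f x)"
proof -
  interpret group_hom M N f
    using assms by (intro group_hom.intro group_hom_axioms.intro)
      (auto simp: rhom_def rmodules_def comm_group_def)
  show "f \<one>\<^bsub>M\<^esub> = \<one>\<^bsub>N\<^esub>" "x \<in> carrier M \<Longrightarrow> f (inv\<^bsub>M\<^esub> x) = inv\<^bsub>N\<^esub> (f x)" by simp_all
qed

lemma
  assumes "M \<in> rmodules" "i \<in> ordinals"
  shows act_closed: "x \<in> carrier M \<Longrightarrow> act M i x \<in> carrier M"
    and act_mult: "x \<in> carrier M \<Longrightarrow> y \<in> carrier M \<Longrightarrow> act M i (x \<otimes>\<^bsub>M\<^esub> y) = act M i x \<otimes>\<^bsub>M\<^esub> act M i y"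
  using assms by (auto simp: rmodules_def hom_def)

lemma
  assumes "M \<in> rmodules" "i \<in> ordinals"
  shows act_one: "act M i \<one>\<^bsub>M\<^esub> = \<one>\<^bsub>M\<^esub>"
    and act_inv: "x \<in> carrier M \<Longrightarrow> act M i (inv\<^bsub>M\<^esub> x) = inv\<^bsub>M\<^esub> (act M i x)"
proof -
  interpret group_hom M M "act M i"
    using assms by (intro group_hom.intro group_hom_axioms.intro)
      (auto simp: rmodules_def comm_group_def)
  show "act M i \<one>\<^bsub>M\<^esub> = \<one>\<^bsub>M\<^esub>" "x \<in> carrier M \<Longrightarrow> act M i (inv\<^bsub>M\<^esub> x) = inv\<^bsub>M\<^esub> (act M i x)"
    by simp_all
qed

locale complex =
  fixes X :: "'u::universe chain_complex"
  assumes complex: "X \<in> chain_complexes"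
begin

lemma obj [simp]: "Obj X n \<in> rmodules"
  using complex by (simp add: chain_complexes_def)

sublocale ob: comm_group "Obj X n" for n
  using obj by (rule rmodule_comm_group)

lemma diff: "Diff X n \<in> rhom (Obj X n) (Obj X (n - 1))"
  using complex by (simp add: chain_complexes_def)

lemma diff_closed [simp]:
  "x \<in> carrier (Obj X n) \<Longrightarrow> m = n - 1 \<Longrightarrow> Diff X n x \<in> carrier (Obj X m)"
  using rhom_closed[OF diff] by simp

lemma diff_mult [simp]:
  "x \<in> carrier (Obj X n) \<Longrightarrow> y \<in> carrier (Obj X n) \<Longrightarrow>
    Diff X n (x \<otimes>\<^bsub>Obj X n\<^esub> y) = Diff X n x \<otimes>\<^bsub>Obj X (n - 1)\<^esub> Diff X n y"
  by (rule rhom_mult[OF diff])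

lemma diff_one [simp]: "Diff X n \<one>\<^bsub>Obj X n\<^esub> = \<one>\<^bsub>Obj X (n - 1)\<^esub>"
  by (rule rhom_one[OF diff obj obj])

lemma diff_inv [simp]:
  "x \<in> carrier (Obj X n) \<Longrightarrow> Diff X n (inv\<^bsub>Obj X n\<^esub> x) = inv\<^bsub>Obj X (n - 1)\<^esub> (Diff X n x)"
  by (rule rhom_inv[OF diff obj obj])

lemma diff_act:
  "i \<in> ordinals \<Longrightarrow> x \<in> carrier (Obj X n) \<Longrightarrow>
    Diff X n (act (Obj X n) i x) = act (Obj X (n - 1)) i (Diff X n x)"
  by (rule rhom_act[OF diff])

lemma diff_diff [simp]:
  "x \<in> carrier (Obj X n) \<Longrightarrow> m = n - 1 \<Longrightarrow> Diff X m (Diff X n x) = \<one>\<^bsub>Obj X (n - 2)\<^esub>"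
  using complex by (simp add: chain_complexes_def)

end

text \<open>
  Families of homomorphisms of degree \<open>k\<close> that need not commute with the differentials. Chain maps
  (\<open>k = 0\<close>) and chain homotopies (\<open>k = 1\<close>) share their rules.
\<close>

locale graded_map = X: complex X + Y: complex Y
  for X Y :: "'u::universe chain_complex" and k :: int and h :: "int \<Rightarrow> 'u \<Rightarrow> 'u" +
  assumes deg: "h n \<in> rhom (Obj X n) (Obj Y (n + k))"
begin

lemma closed [simp]: "x \<in> carrier (Obj X n) \<Longrightarrow> m = n + k \<Longrightarrow> h n x \<in> carrier (Obj Y m)"
  using rhom_closed[OF deg] by simp

lemma mult [simp]:
  "x \<in> carrier (Obj X n) \<Longrightarrow> y \<in> carrier (Obj X n) \<Longrightarrow>
    h n (x \<otimes>\<^bsub>Obj X n\<^esub> y) = h n x \<otimes>\<^bsub>Obj Y (n + k)\<^esub> h n y"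
  by (rule rhom_mult[OF deg])

lemma one [simp]: "h n \<one>\<^bsub>Obj X n\<^esub> = \<one>\<^bsub>Obj Y (n + k)\<^esub>"
  by (rule rhom_one[OF deg X.obj Y.obj])

lemma inv [simp]:
  "x \<in> carrier (Obj X n) \<Longrightarrow> h n (inv\<^bsub>Obj X n\<^esub> x) = inv\<^bsub>Obj Y (n + k)\<^esub> (h n x)"
  by (rule rhom_inv[OF deg X.obj Y.obj])

lemma act:
  "i \<in> ordinals \<Longrightarrow> x \<in> carrier (Obj X n) \<Longrightarrow>
    h n (act (Obj X n) i x) = act (Obj Y (n + k)) i (h n x)"
  by (rule rhom_act[OF deg])

end

locale chain_map = X: complex X + Y: complex Y
  for X Y :: "'u::universe chain_complex" and f :: "int \<Rightarrow> 'u \<Rightarrow> 'u" +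
  assumes chain_map: "f \<in> chain_maps X Y"
begin

sublocale graded_map X Y 0 f
  using chain_map by unfold_locales (simp add: chain_maps_def)

lemma diff_map: "x \<in> carrier (Obj X n) \<Longrightarrow> Diff Y n (f n x) = f (n - 1) (Diff X n x)"
  using chain_map by (simp add: chain_maps_def)

end

lemma chain_map_intro:
  "X \<in> chain_complexes \<Longrightarrow> Y \<in> chain_complexes \<Longrightarrow> f \<in> chain_maps X Y \<Longrightarrow> chain_map X Y f"
  by unfold_locales

lemma chain_mapsI:
  assumes "\<And>n. f n \<in> rhom (Obj X n) (Obj Y n)"
    and "\<And>n x. x \<in> carrier (Obj X n) \<Longrightarrow> Diff Y n (f n x) = f (n - 1) (Diff X n x)"
  shows "f \<in> chain_maps X Y"
  using assms by (simp add: chain_maps_def)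

lemma chain_comp_apply [simp]: "x \<in> carrier (Obj X n) \<Longrightarrow> chain_comp X g f n x = g n (f n x)"
  by (simp add: chain_comp_def compose_def)

lemma chain_comp_maps:
  assumes "X \<in> chain_complexes" "Y \<in> chain_complexes" "Z \<in> chain_complexes"
    and "f \<in> chain_maps X Y" "g \<in> chain_maps Y Z"
  shows "chain_comp X g f \<in> chain_maps X Z"
proof -
  interpret f: chain_map X Y f using assms by unfold_locales
  interpret g: chain_map Y Z g using assms by unfold_locales
  show ?thesis
  proof (rule chain_mapsI)
    fix n
    show "chain_comp X g f n \<in> rhom (Obj X n) (Obj Z n)"
      unfolding chain_comp_def compose_def by (rule rhomI) (simp_all add: f.act g.act)
  next
    fix n x assume x: "x \<in> carrier (Obj X n)"
    then show "Diff Z n (chain_comp X g f n x) = chain_comp X g f (n - 1) (Diff X n x)"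
      by (simp add: f.diff_map g.diff_map)
  qed
qed

lemma chain_id_maps: "X \<in> chain_complexes \<Longrightarrow> chain_id X \<in> chain_maps X X"
proof -
  assume "X \<in> chain_complexes"
  then interpret complex X by unfold_locales
  show ?thesis
    unfolding chain_id_def
    by (intro chain_mapsI rhomI) (simp_all add: diff_act act_closed[OF obj])
qed

lemma chain_maps_eqI:
  assumes "f \<in> chain_maps X Y" "g \<in> chain_maps X Y"
    and "\<And>n x. x \<in> carrier (Obj X n) \<Longrightarrow> f n x = g n x"
  shows "f = g"
proof
  fix n
  have "f n \<in> extensional (carrier (Obj X n))" "g n \<in> extensional (carrier (Obj X n))"
    using assms(1,2) rhom_extensional unfolding chain_maps_def by blast+
  then show "f n = g n" using assms(3) by (rule extensionalityI)
qed

section \<open>Chain homotopy\<close>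

text \<open>
  The equation is solved for \<open>f\<close>, so that most verifications need only associativity and commutativity.
\<close>

definition homotopy ::
  "'u::universe chain_complex \<Rightarrow> 'u chain_complex \<Rightarrow> (int \<Rightarrow> 'u \<Rightarrow> 'u) \<Rightarrow>
    (int \<Rightarrow> 'u \<Rightarrow> 'u) \<Rightarrow> (int \<Rightarrow> 'u \<Rightarrow> 'u) \<Rightarrow> bool" where
  "homotopy X Y h f g \<longleftrightarrow> graded_map X Y 1 h \<and> (\<forall>n. \<forall>x\<in>carrier (Obj X n).
     f n x = g n x \<otimes>\<^bsub>Obj Y n\<^esub> (Diff Y (n + 1) (h n x) \<otimes>\<^bsub>Obj Y n\<^esub> h (n - 1) (Diff X n x)))"

lemma (in comm_group) mult_inv_eq_iff:
  assumes "x \<in> carrier G" "y \<in> carrier G" "z \<in> carrier G"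
  shows "x \<otimes> inv y = z \<longleftrightarrow> x = y \<otimes> z"
  using assms by (metis inv_solve_right m_comm)

lemma homotopy_rel_iff:
  assumes "X \<in> chain_complexes" "Y \<in> chain_complexes"
  shows "(f, g) \<in> homotopy_rel X Y \<longleftrightarrow>
    f \<in> chain_maps X Y \<and> g \<in> chain_maps X Y \<and> (\<exists>h. homotopy X Y h f g)"
proof -
  interpret X: complex X using assms by unfold_locales
  interpret Y: complex Y using assms by unfold_locales
  have "(\<forall>n. h n \<in> rhom (Obj X n) (Obj Y (n + 1)) \<and>
       (\<forall>x\<in>carrier (Obj X n).
          f n x \<otimes>\<^bsub>Obj Y n\<^esub> inv\<^bsub>Obj Y n\<^esub> (g n x) =
          Diff Y (n + 1) (h n x) \<otimes>\<^bsub>Obj Y n\<^esub> h (n - 1) (Diff X n x)))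
     \<longleftrightarrow> homotopy X Y h f g"
    if f: "f \<in> chain_maps X Y" and g: "g \<in> chain_maps X Y" for h
  proof (cases "\<forall>n. h n \<in> rhom (Obj X n) (Obj Y (n + 1))")
    case True
    interpret f: chain_map X Y f using f by unfold_locales
    interpret g: chain_map X Y g using g by unfold_locales
    interpret h: graded_map X Y 1 h using True by unfold_locales simp
    show ?thesis
      unfolding homotopy_def using h.graded_map_axioms True
      by (simp add: Y.ob.mult_inv_eq_iff)
  next
    case False
    then have "\<not> homotopy X Y h f g"
      unfolding homotopy_def using graded_map.deg by blast
    then show ?thesis using False by blast
  qed
  then show ?thesis unfolding homotopy_rel_def by blast
qed

lemma homotopy_refl:
  assumes "chain_map X Y f"
  shows "homotopy X Y (\<lambda>n. \<lambda>x\<in>carrier (Obj X n). \<one>\<^bsub>Obj Y (n + 1)\<^esub>) f f"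
proof -
  interpret f: chain_map X Y f by fact
  have "graded_map X Y 1 (\<lambda>n. \<lambda>x\<in>carrier (Obj X n). \<one>\<^bsub>Obj Y (n + 1)\<^esub>)"
    by unfold_locales (rule rhomI, simp_all add: act_one[OF f.Y.obj])
  then show ?thesis unfolding homotopy_def by simp
qed

lemma homotopy_sym:
  assumes h: "homotopy X Y h f g" and "chain_map X Y f" "chain_map X Y g"
  shows "homotopy X Y (\<lambda>n. \<lambda>x\<in>carrier (Obj X n). inv\<^bsub>Obj Y (n + 1)\<^esub> (h n x)) g f"
proof -
  interpret f: chain_map X Y f by fact
  interpret g: chain_map X Y g by fact
  interpret h: graded_map X Y 1 h using h by (simp add: homotopy_def)
  have "graded_map X Y 1 (\<lambda>n. \<lambda>x\<in>carrier (Obj X n). inv\<^bsub>Obj Y (n + 1)\<^esub> (h n x))"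
    by unfold_locales
      (rule rhomI, simp_all add: act_inv[OF f.Y.obj] h.act f.Y.ob.inv_mult)
  moreover have "g n x = f n x \<otimes>\<^bsub>Obj Y n\<^esub>
      (inv\<^bsub>Obj Y n\<^esub> Diff Y (n + 1) (h n x) \<otimes>\<^bsub>Obj Y n\<^esub> inv\<^bsub>Obj Y n\<^esub> h (n - 1) (Diff X n x))"
    if x: "x \<in> carrier (Obj X n)" for n x
  proof -
    have c: "f n x = g n x \<otimes>\<^bsub>Obj Y n\<^esub> (Diff Y (n + 1) (h n x) \<otimes>\<^bsub>Obj Y n\<^esub> h (n - 1) (Diff X n x))"
      using h x by (simp add: homotopy_def)
    show ?thesis
      using x by (simp add: f.Y.ob.inv_mult[symmetric] f.Y.ob.mult_inv_eq_iff[symmetric] c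
          f.Y.ob.m_assoc)
  qed
  ultimately show ?thesis unfolding homotopy_def by simp
qed

lemma homotopy_trans:
  assumes h: "homotopy X Y h f g" and k: "homotopy X Y k g l" and "chain_map X Y l"
  shows "homotopy X Y (\<lambda>n. \<lambda>x\<in>carrier (Obj X n). h n x \<otimes>\<^bsub>Obj Y (n + 1)\<^esub> k n x) f l"
proof -
  interpret l: chain_map X Y l by fact
  interpret h: graded_map X Y 1 h using h by (simp add: homotopy_def)
  interpret k: graded_map X Y 1 k using k by (simp add: homotopy_def)
  have "graded_map X Y 1 (\<lambda>n. \<lambda>x\<in>carrier (Obj X n). h n x \<otimes>\<^bsub>Obj Y (n + 1)\<^esub> k n x)"
    by unfold_locales
      (rule rhomI, simp_all add: act_mult[OF l.Y.obj] h.act k.act l.Y.ob.m_ac)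
  moreover have "f n x = l n x \<otimes>\<^bsub>Obj Y n\<^esub>
      ((Diff Y (n + 1) (h n x) \<otimes>\<^bsub>Obj Y n\<^esub> Diff Y (n + 1) (k n x)) \<otimes>\<^bsub>Obj Y n\<^esub>
        (h (n - 1) (Diff X n x) \<otimes>\<^bsub>Obj Y n\<^esub> k (n - 1) (Diff X n x)))"
    if x: "x \<in> carrier (Obj X n)" for n x
  proof -
    have "f n x = g n x \<otimes>\<^bsub>Obj Y n\<^esub> (Diff Y (n + 1) (h n x) \<otimes>\<^bsub>Obj Y n\<^esub> h (n - 1) (Diff X n x))"
      using h x by (simp add: homotopy_def)
    moreover have "g n x = l n x \<otimes>\<^bsub>Obj Y n\<^esub> (Diff Y (n + 1) (k n x) \<otimes>\<^bsub>Obj Y n\<^esub> k (n - 1) (Diff X n x))"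
      using k x by (simp add: homotopy_def)
    ultimately show ?thesis using x by (simp add: l.Y.ob.m_ac)
  qed
  ultimately show ?thesis unfolding homotopy_def by simp
qed

text \<open>
  If \<open>h\<close> is a homotopy from \<open>f'\<close> to \<open>f\<close> then \<open>g h\<close> is one from \<open>g f'\<close> to \<open>g f\<close>; the
  index shift is the degree of \<open>h\<close>.
\<close>

lemma homotopy_comp_left:
  assumes h: "homotopy X Y h f f'" and "chain_map X Y f'" "chain_map Y Z g"
  shows "homotopy X Z (chain_comp X (\<lambda>n. g (n + 1)) h) (chain_comp X g f) (chain_comp X g f')"
proof -
  interpret g: chain_map Y Z g by fact
  interpret f': chain_map X Y f' by fact
  interpret h: graded_map X Y 1 h using h by (simp add: homotopy_def)
  have "graded_map X Z 1 (chain_comp X (\<lambda>n. g (n + 1)) h)"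
    unfolding chain_comp_def compose_def
    by unfold_locales (rule rhomI, simp_all add: h.act g.act)
  then show ?thesis using h by (simp add: homotopy_def g.diff_map)
qed

lemma homotopy_comp_right:
  assumes k: "homotopy Y Z k g g'" and "chain_map X Y f"
  shows "homotopy X Z (chain_comp X k f) (chain_comp X g f) (chain_comp X g' f)"
proof -
  interpret f: chain_map X Y f by fact
  interpret k: graded_map Y Z 1 k using k by (simp add: homotopy_def)
  have "graded_map X Z 1 (chain_comp X k f)"
    unfolding chain_comp_def compose_def
    by unfold_locales (rule rhomI, simp_all add: f.act k.act)
  then show ?thesis using k by (simp add: homotopy_def f.diff_map)
qed

lemma homotopy_equiv:
  assumes X: "X \<in> chain_complexes" and Y: "Y \<in> chain_complexes"
  shows "equiv (chain_maps X Y) (homotopy_rel X Y)"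
proof (rule equivI)
  note rel = homotopy_rel_iff[OF X Y] and map = chain_map_intro[OF X Y]
  show "homotopy_rel X Y \<subseteq> chain_maps X Y \<times> chain_maps X Y" by (auto simp: rel)
  show "refl_on (chain_maps X Y) (homotopy_rel X Y)"
    unfolding refl_on_def using rel map homotopy_refl by blast
  show "sym (homotopy_rel X Y)"
    unfolding sym_def using rel map homotopy_sym by blast
  show "trans (homotopy_rel X Y)"
  proof (rule transI)
    fix f g l assume fg: "(f, g) \<in> homotopy_rel X Y" and gl: "(g, l) \<in> homotopy_rel X Y"
    obtain h where h: "homotopy X Y h f g" using fg by (auto simp: rel)
    obtain k where k: "homotopy X Y k g l" and l: "l \<in> chain_maps X Y" using gl by (auto simp: rel)
    show "(f, l) \<in> homotopy_rel X Y"
      using homotopy_trans[OF h k map[OF l]] fg gl by (auto simp: rel)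
  qed
qed

lemma chain_comp_homotopic:
  assumes X: "X \<in> chain_complexes" and Y: "Y \<in> chain_complexes" and Z: "Z \<in> chain_complexes"
    and f: "(f, f') \<in> homotopy_rel X Y" and g: "(g, g') \<in> homotopy_rel Y Z"
  shows "(chain_comp X g f, chain_comp X g' f') \<in> homotopy_rel X Z"
proof -
  note cm = homotopy_rel_iff[OF X Y] homotopy_rel_iff[OF Y Z] homotopy_rel_iff[OF X Z]
  obtain h where h: "homotopy X Y h f f'" and fm: "f \<in> chain_maps X Y" "f' \<in> chain_maps X Y"
    using f by (auto simp: cm)
  obtain k where k: "homotopy Y Z k g g'" and gm: "g \<in> chain_maps Y Z" "g' \<in> chain_maps Y Z"
    using g by (auto simp: cm)
  have comps: "chain_comp X g f \<in> chain_maps X Z" "chain_comp X g f' \<in> chain_maps X Z"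
      "chain_comp X g' f' \<in> chain_maps X Z"
    using chain_comp_maps[OF X Y Z] fm gm by auto
  have 1: "(chain_comp X g f, chain_comp X g f') \<in> homotopy_rel X Z"
    using comps homotopy_comp_left[OF h chain_map_intro[OF X Y fm(2)] chain_map_intro[OF Y Z gm(1)]]
    by (auto simp: cm)
  have 2: "(chain_comp X g f', chain_comp X g' f') \<in> homotopy_rel X Z"
    using comps homotopy_comp_right[OF k chain_map_intro[OF X Y fm(2)]] by (auto simp: cm)
  show ?thesis
    using homotopy_equiv[OF X Z] 1 2 by (auto simp: equiv_def dest: transD)
qed

section \<open>The homotopy category\<close>

abbreviation hclass ::
  "'u::universe chain_complex \<Rightarrow> 'u chain_complex \<Rightarrow> (int \<Rightarrow> 'u \<Rightarrow> 'u) \<Rightarrow> (int \<Rightarrow> 'u \<Rightarrow> 'u) set" where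
  "hclass X Y f \<equiv> homotopy_rel X Y `` {f}"

lemma Hom_homotopy_cat_iff:
  "a \<in> Hom homotopy_cat X Y \<longleftrightarrow> (\<exists>f\<in>chain_maps X Y. a = hclass X Y f)"
  by (auto simp: homotopy_cat_def quotient_def)

lemma hclass_in_Hom: "f \<in> chain_maps X Y \<Longrightarrow> hclass X Y f \<in> Hom homotopy_cat X Y"
  by (auto simp: Hom_homotopy_cat_iff)

lemma Id_homotopy_cat: "Id homotopy_cat X = hclass X X (chain_id X)"
  by (simp add: homotopy_cat_def)

lemma hclass_eq_iff:
  assumes "X \<in> chain_complexes" "Y \<in> chain_complexes" "f \<in> chain_maps X Y" "g \<in> chain_maps X Y"
  shows "hclass X Y f = hclass X Y g \<longleftrightarrow> (f, g) \<in> homotopy_rel X Y"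
  using eq_equiv_class_iff[OF homotopy_equiv] assms by blast

text \<open>
  Composition and suspension of homotopy classes are unions over representatives. The union is a single
  class as soon as all representatives contribute the same one.
\<close>

lemma UN_hclass_constant:
  assumes X: "X \<in> chain_complexes" and Y: "Y \<in> chain_complexes"
    and f: "f \<in> chain_maps X Y" and F: "\<And>f'. (f, f') \<in> homotopy_rel X Y \<Longrightarrow> F f' = c"
  shows "(\<Union>f'\<in>hclass X Y f. F f') = c"
proof -
  have "f \<in> hclass X Y f" using equiv_class_self[OF homotopy_equiv[OF X Y] f] .
  then show ?thesis using F by auto
qed

lemma Comp_homotopy_cat:
  assumes X: "X \<in> chain_complexes" and Y: "Y \<in> chain_complexes" and Z: "Z \<in> chain_complexes"
    and f: "f \<in> chain_maps X Y" and g: "g \<in> chain_maps Y Z"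
  shows "Comp homotopy_cat X Y Z (hclass Y Z g) (hclass X Y f) = hclass X Z (chain_comp X g f)"
proof -
  have "hclass X Z (chain_comp X g' f') = hclass X Z (chain_comp X g f)"
    if "(f, f') \<in> homotopy_rel X Y" "(g, g') \<in> homotopy_rel Y Z" for f' g'
    using equiv_class_eq[OF homotopy_equiv[OF X Z] chain_comp_homotopic[OF X Y Z that]] by simp
  then have "(\<Union>f'\<in>hclass X Y f. \<Union>g'\<in>hclass Y Z g. hclass X Z (chain_comp X g' f')) =
      hclass X Z (chain_comp X g f)"
    by (intro UN_hclass_constant[OF X Y f] UN_hclass_constant[OF Y Z g])
  then show ?thesis by (simp add: homotopy_cat_def)
qed

lemma chain_comp_id_left:
  assumes "X \<in> chain_complexes" "Y \<in> chain_complexes" "f \<in> chain_maps X Y"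
  shows "chain_comp X (chain_id Y) f = f"
proof -
  interpret chain_map X Y f using assms by unfold_locales
  show ?thesis
    using assms
    by (intro chain_maps_eqI[of _ X Y] chain_comp_maps[of _ Y] chain_id_maps) (auto simp: chain_id_def)
qed

lemma chain_comp_id_right:
  assumes "X \<in> chain_complexes" "Y \<in> chain_complexes" "f \<in> chain_maps X Y"
  shows "chain_comp X f (chain_id X) = f"
  using assms
  by (intro chain_maps_eqI[of _ X Y] chain_comp_maps[of _ X] chain_id_maps) (auto simp: chain_id_def)

lemma Comp_Id_left:
  assumes "X \<in> chain_complexes" "Y \<in> chain_complexes" "a \<in> Hom homotopy_cat X Y"
  shows "Comp homotopy_cat X Y Y (Id homotopy_cat Y) a = a"
  using assms
  by (auto simp: Hom_homotopy_cat_iff Id_homotopy_cat Comp_homotopy_cat chain_id_maps chain_comp_id_left)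

lemma Comp_Id_right:
  assumes "X \<in> chain_complexes" "Y \<in> chain_complexes" "a \<in> Hom homotopy_cat X Y"
  shows "Comp homotopy_cat X X Y a (Id homotopy_cat X) = a"
  using assms
  by (auto simp: Hom_homotopy_cat_iff Id_homotopy_cat Comp_homotopy_cat chain_id_maps chain_comp_id_right)

lemma Id_iso:
  assumes "X \<in> chain_complexes"
  shows "Id homotopy_cat X \<in> isos homotopy_cat X X"
proof -
  have "Id homotopy_cat X \<in> Hom homotopy_cat X X"
    using assms by (simp add: Id_homotopy_cat hclass_in_Hom chain_id_maps)
  then show ?thesis unfolding isos_def using assms Comp_Id_left by blast
qed

section \<open>Suspension\<close>

lemma suspension_complex:
  assumes "X \<in> chain_complexes"
  shows "suspension X \<in> chain_complexes"
proof -
  interpret complex X using assms by unfold_locales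
  have "(\<lambda>x\<in>carrier (Obj X (n - 1)). inv\<^bsub>Obj X (n - 2)\<^esub> (Diff X (n - 1) x))
      \<in> rhom (Obj X (n - 1)) (Obj X (n - 2))" for n
    by (rule rhomI) (simp_all add: ob.inv_mult diff_act act_inv[OF obj])
  then show ?thesis unfolding chain_complexes_def by (simp add: suspension_def)
qed

lemma suspension_chain_map:
  assumes "X \<in> chain_complexes" "Y \<in> chain_complexes" "f \<in> chain_maps X Y"
  shows "(\<lambda>n. f (n - 1)) \<in> chain_maps (suspension X) (suspension Y)"
proof -
  interpret chain_map X Y f using assms by unfold_locales
  show ?thesis
    using deg by (intro chain_mapsI) (simp_all add: suspension_def diff_map)
qed

text \<open>
  The suspension changes the sign of the differential, which the sign of the homotopy compensates.
\<close>

lemma suspension_homotopy: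
  assumes h: "homotopy X Y h f g" and "chain_map X Y g"
  shows "homotopy (suspension X) (suspension Y)
    (\<lambda>n. \<lambda>x\<in>carrier (Obj X (n - 1)). inv\<^bsub>Obj Y n\<^esub> (h (n - 1) x)) (\<lambda>n. f (n - 1)) (\<lambda>n. g (n - 1))"
    (is "homotopy ?X ?Y ?h _ _")
proof -
  interpret g: chain_map X Y g by fact
  interpret h: graded_map X Y 1 h using h by (simp add: homotopy_def)
  interpret SX: complex ?X using suspension_complex[OF g.X.complex] by unfold_locales
  interpret SY: complex ?Y using suspension_complex[OF g.Y.complex] by unfold_locales
  have "?h n \<in> rhom (Obj X (n - 1)) (Obj Y n)" for n
    by (rule rhomI) (simp_all add: h.act act_inv[OF g.Y.obj] g.Y.ob.inv_mult)
  then have "graded_map ?X ?Y 1 ?h"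
    by unfold_locales (simp add: suspension_def)
  then show ?thesis
    using h by (simp add: homotopy_def suspension_def)
qed

lemma susp_mor_hclass:
  assumes X: "X \<in> chain_complexes" and Y: "Y \<in> chain_complexes" and f: "f \<in> chain_maps X Y"
  shows "susp_mor X Y (hclass X Y f) = hclass (suspension X) (suspension Y) (\<lambda>n. f (n - 1))"
  unfolding susp_mor_def
proof (rule UN_hclass_constant[OF X Y f])
  note S = suspension_complex[OF X] suspension_complex[OF Y]
  fix f' assume rel: "(f, f') \<in> homotopy_rel X Y"
  then obtain h where h: "homotopy X Y h f f'" and f': "f' \<in> chain_maps X Y"
    by (auto simp: homotopy_rel_iff[OF X Y])
  have "((\<lambda>n. f (n - 1)), (\<lambda>n. f' (n - 1))) \<in> homotopy_rel (suspension X) (suspension Y)"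
    using suspension_homotopy[OF h chain_map_intro[OF X Y f']] suspension_chain_map[OF X Y] f f'
    by (auto simp: homotopy_rel_iff[OF S])
  then show "hclass (suspension X) (suspension Y) (\<lambda>n. f' (n - 1)) =
      hclass (suspension X) (suspension Y) (\<lambda>n. f (n - 1))"
    using equiv_class_eq[OF homotopy_equiv[OF S]] by metis
qed

lemma susp_mor_Id:
  assumes "X \<in> chain_complexes"
  shows "susp_mor X X (Id homotopy_cat X) = Id homotopy_cat (suspension X)"
proof -
  have "(\<lambda>n. chain_id X (n - 1)) = chain_id (suspension X)"
    by (auto simp: chain_id_def suspension_def)
  then show ?thesis using assms by (simp add: Id_homotopy_cat susp_mor_hclass chain_id_maps)
qed

section \<open>Direct sums and mapping cones\<close>

lemma carrier_dsum: "carrier (dsum M N) = {opair x y | x y. x \<in> carrier M \<and> y \<in> carrier N}"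
  and opair_dsum_iff [simp]: "opair x y \<in> carrier (dsum M N) \<longleftrightarrow> x \<in> carrier M \<and> y \<in> carrier N"
  and mult_dsum [simp]:
    "opair x y \<otimes>\<^bsub>dsum M N\<^esub> opair x' y' = opair (x \<otimes>\<^bsub>M\<^esub> x') (y \<otimes>\<^bsub>N\<^esub> y')"
  and one_dsum [simp]: "\<one>\<^bsub>dsum M N\<^esub> = opair \<one>\<^bsub>M\<^esub> \<one>\<^bsub>N\<^esub>"
  and act_dsum [simp]: "act (dsum M N) i (opair x y) = opair (act M i x) (act N i y)"
  by (auto simp: dsum_def)

lemma dsumE:
  assumes "p \<in> carrier (dsum M N)"
  obtains x y where "p = opair x y" "x \<in> carrier M" "y \<in> carrier N"
  using assms by (auto simp: carrier_dsum)

lemma comm_group_dsum: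
  assumes "comm_group M" "comm_group N"
  shows "comm_group (dsum M N)"
proof -
  interpret M: comm_group M by fact
  interpret N: comm_group N by fact
  show ?thesis
  proof (rule comm_groupI)
    fix p assume "p \<in> carrier (dsum M N)"
    then obtain x y where p: "p = opair x y" "x \<in> carrier M" "y \<in> carrier N" by (rule dsumE)
    then show "\<exists>q\<in>carrier (dsum M N). q \<otimes>\<^bsub>dsum M N\<^esub> p = \<one>\<^bsub>dsum M N\<^esub>"
      by (intro bexI[of _ "opair (inv\<^bsub>M\<^esub> x) (inv\<^bsub>N\<^esub> y)"]) simp_all
  qed (auto elim!: dsumE simp: M.m_ac N.m_ac)
qed

lemma dsum_rmodule:
  assumes M: "M \<in> rmodules" and N: "N \<in> rmodules"
  shows "dsum M N \<in> rmodules"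
proof -
  obtain m n where "elts m = carrier M" "elts n = carrier N" using M N by (auto simp: rmodules_def)
  then have "\<exists>z. elts z = carrier (dsum M N)" using small_product[of m n] by (simp add: carrier_dsum)
  moreover have "comm_group (dsum M N)"
    using M N by (intro comm_group_dsum rmodule_comm_group)
  moreover have "act (dsum M N) i \<in> hom (dsum M N) (dsum M N)" if "i \<in> ordinals" for i
    by (intro homI) (auto elim!: dsumE simp: act_closed[OF M that] act_closed[OF N that]
        act_mult[OF M that] act_mult[OF N that])
  moreover have "act (dsum M N) i (act (dsum M N) j p) = act (dsum M N) j (act (dsum M N) i p)"
    if "i \<in> ordinals" "j \<in> ordinals" "p \<in> carrier (dsum M N)" for i j p
    using that M N by (auto elim!: dsumE simp: rmodules_def)
  ultimately show ?thesis by (simp add: rmodules_def)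
qed

lemma Obj_cone [simp]: "Obj (cone X Y f) n = dsum (Obj X (n - 1)) (Obj Y n)"
  by (simp add: cone_def)

lemma Diff_cone [simp]:
  "x \<in> carrier (Obj X (n - 1)) \<Longrightarrow> y \<in> carrier (Obj Y n) \<Longrightarrow>
    Diff (cone X Y f) n (opair x y) =
      opair (inv\<^bsub>Obj X (n - 2)\<^esub> (Diff X (n - 1) x)) (f (n - 1) x \<otimes>\<^bsub>Obj Y (n - 1)\<^esub> Diff Y n y)"
  by (simp add: cone_def)

context chain_map
begin

lemma cone_complex: "cone X Y f \<in> chain_complexes"
proof -
  have obj: "Obj (cone X Y f) n \<in> rmodules" for n by (simp add: dsum_rmodule)
  have "Diff (cone X Y f) n \<in> rhom (Obj (cone X Y f) n) (Obj (cone X Y f) (n - 1))" for n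
  proof -
    have "restrict (Diff (cone X Y f) n) (carrier (Obj (cone X Y f) n))
        \<in> rhom (Obj (cone X Y f) n) (Obj (cone X Y f) (n - 1))"
    proof (rule rhomI[OF obj])
      fix p q assume p: "p \<in> carrier (Obj (cone X Y f) n)" and q: "q \<in> carrier (Obj (cone X Y f) n)"
      show "Diff (cone X Y f) n p \<in> carrier (Obj (cone X Y f) (n - 1))"
        using p by (auto elim!: dsumE)
      show "Diff (cone X Y f) n (p \<otimes>\<^bsub>Obj (cone X Y f) n\<^esub> q) =
          Diff (cone X Y f) n p \<otimes>\<^bsub>Obj (cone X Y f) (n - 1)\<^esub> Diff (cone X Y f) n q"
        using p q by (auto elim!: dsumE simp: X.ob.inv_mult Y.ob.m_ac)
    next
      fix i p :: 'u assume i: "i \<in> ordinals" and p: "p \<in> carrier (Obj (cone X Y f) n)"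
      show "Diff (cone X Y f) n (act (Obj (cone X Y f) n) i p) =
          act (Obj (cone X Y f) (n - 1)) i (Diff (cone X Y f) n p)"
        using i p by (auto elim!: dsumE simp: act_closed[OF X.obj] act_closed[OF Y.obj]
            act_mult[OF Y.obj] act_inv[OF X.obj] act X.diff_act Y.diff_act)
    qed
    then show ?thesis by (simp add: cone_def)
  qed
  moreover have "Diff (cone X Y f) (n - 1) (Diff (cone X Y f) n p) = \<one>\<^bsub>Obj (cone X Y f) (n - 2)\<^esub>"
    if "p \<in> carrier (Obj (cone X Y f) n)" for n p
    using that by (auto elim!: dsumE simp: diff_map)
  ultimately show ?thesis using obj by (simp add: chain_complexes_def)
qed

lemma cone_in_map: "cone_in X Y \<in> chain_maps Y (cone X Y f)"
  unfolding cone_in_def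
  by (intro chain_mapsI rhomI) (simp_all add: act_one[OF X.obj] act_closed[OF Y.obj])

lemma cone_out_map: "cone_out X Y \<in> chain_maps (cone X Y f) (suspension X)"
proof (rule chain_mapsI)
  fix n
  show "cone_out X Y n \<in> rhom (Obj (cone X Y f) n) (Obj (suspension X) n)"
    unfolding cone_out_def Obj_cone
    by (intro rhomI) (auto elim!: dsumE simp: dsum_rmodule suspension_def)
next
  fix n p assume "p \<in> carrier (Obj (cone X Y f) n)"
  then obtain x y where p: "p = opair x y" "x \<in> carrier (Obj X (n - 1))" "y \<in> carrier (Obj Y n)"
    unfolding Obj_cone by (rule dsumE)
  then show "Diff (suspension X) n (cone_out X Y n p) = cone_out X Y (n - 1) (Diff (cone X Y f) n p)"
    by (simp add: suspension_def cone_out_def)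
qed

text \<open>
  The isomorphism with a cone triangle consists of identities; the square with the suspended morphism
  then rests on \<open>susp_mor_Id\<close>.
\<close>

lemma cone_triangle_distinguished:
  "(X, Y, cone X Y f, hclass X Y f, hclass Y (cone X Y f) (cone_in X Y),
    hclass (cone X Y f) (suspension X) (cone_out X Y)) \<in> distinguished"
proof -
  note cs = X.complex Y.complex cone_complex suspension_complex[OF X.complex]
  note homs = hclass_in_Hom[OF chain_map] hclass_in_Hom[OF cone_in_map] hclass_in_Hom[OF cone_out_map]
  have "(X, Y, cone X Y f, hclass X Y f, hclass Y (cone X Y f) (cone_in X Y),
    hclass (cone X Y f) (suspension X) (cone_out X Y)) \<in> cone_triangles"
    unfolding cone_triangles_def using X.complex Y.complex chain_map by blast
  then show ?thesis
    unfolding distinguished_def using cs homs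
    by (auto intro!: bexI[OF _ Id_iso[OF X.complex]] bexI[OF _ Id_iso[OF Y.complex]]
        bexI[OF _ Id_iso[OF cone_complex]] elim!: bexI[rotated]
        simp: Comp_Id_left Comp_Id_right susp_mor_Id)
qed

end

section \<open>Quasi-isomorphisms\<close>

text \<open>
  Surjectivity and injectivity on homology are stated for cycles and boundaries, without forming the
  homology groups.
\<close>

definition homology_surj ::
  "'u::universe chain_complex \<Rightarrow> 'u chain_complex \<Rightarrow> (int \<Rightarrow> 'u \<Rightarrow> 'u) \<Rightarrow> bool" where
  "homology_surj X Y f \<longleftrightarrow> (\<forall>n. \<forall>y\<in>carrier (Obj Y n). Diff Y n y = \<one>\<^bsub>Obj Y (n - 1)\<^esub> \<longrightarrow>
     (\<exists>x\<in>carrier (Obj X n). Diff X n x = \<one>\<^bsub>Obj X (n - 1)\<^esub> \<and>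
       (\<exists>w\<in>carrier (Obj Y (n + 1)). y = f n x \<otimes>\<^bsub>Obj Y n\<^esub> Diff Y (n + 1) w)))"

definition homology_inj ::
  "'u::universe chain_complex \<Rightarrow> 'u chain_complex \<Rightarrow> (int \<Rightarrow> 'u \<Rightarrow> 'u) \<Rightarrow> bool" where
  "homology_inj X Y f \<longleftrightarrow> (\<forall>n. \<forall>x\<in>carrier (Obj X n). Diff X n x = \<one>\<^bsub>Obj X (n - 1)\<^esub> \<longrightarrow>
     (\<exists>w\<in>carrier (Obj Y (n + 1)). Diff Y (n + 1) w = f n x) \<longrightarrow>
     (\<exists>w\<in>carrier (Obj X (n + 1)). Diff X (n + 1) w = x))"

lemma homology_surjE:
  assumes "homology_surj X Y f" "y \<in> carrier (Obj Y n)" "Diff Y n y = \<one>\<^bsub>Obj Y (n - 1)\<^esub>"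
  obtains x w where "x \<in> carrier (Obj X n)" "Diff X n x = \<one>\<^bsub>Obj X (n - 1)\<^esub>"
    "w \<in> carrier (Obj Y (n + 1))" "y = f n x \<otimes>\<^bsub>Obj Y n\<^esub> Diff Y (n + 1) w"
  using assms unfolding homology_surj_def by blast

lemma homology_injE:
  assumes "homology_inj X Y f" "x \<in> carrier (Obj X n)" "Diff X n x = \<one>\<^bsub>Obj X (n - 1)\<^esub>"
    "v \<in> carrier (Obj Y (n + 1))" "Diff Y (n + 1) v = f n x"
  obtains w where "w \<in> carrier (Obj X (n + 1))" "Diff X (n + 1) w = x"
  using assms unfolding homology_inj_def by blast

text \<open>
  On a cycle, homotopic maps differ by a boundary.
\<close>

lemma homology_surj_homotopic:
  assumes X: "X \<in> chain_complexes" and Y: "Y \<in> chain_complexes"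
    and rel: "(f, g) \<in> homotopy_rel X Y" and f: "homology_surj X Y f"
  shows "homology_surj X Y g"
proof -
  obtain h where h: "homotopy X Y h f g" "g \<in> chain_maps X Y"
    using rel by (auto simp: homotopy_rel_iff[OF X Y])
  interpret g: chain_map X Y g using X Y h by unfold_locales
  interpret h: graded_map X Y 1 h using h by (simp add: homotopy_def)
  show ?thesis
    unfolding homology_surj_def
  proof (intro allI ballI impI)
    fix n y assume "y \<in> carrier (Obj Y n)" "Diff Y n y = \<one>\<^bsub>Obj Y (n - 1)\<^esub>"
    with f obtain x w where x: "x \<in> carrier (Obj X n)" "Diff X n x = \<one>\<^bsub>Obj X (n - 1)\<^esub>"
      "w \<in> carrier (Obj Y (n + 1))" "y = f n x \<otimes>\<^bsub>Obj Y n\<^esub> Diff Y (n + 1) w" by (rule homology_surjE)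
    moreover have "f n x = g n x \<otimes>\<^bsub>Obj Y n\<^esub> Diff Y (n + 1) (h n x)"
      using h x by (simp add: homotopy_def)
    ultimately have "y = g n x \<otimes>\<^bsub>Obj Y n\<^esub> Diff Y (n + 1) (h n x \<otimes>\<^bsub>Obj Y (n + 1)\<^esub> w)"
      by (simp add: g.Y.ob.m_assoc)
    moreover have "h n x \<otimes>\<^bsub>Obj Y (n + 1)\<^esub> w \<in> carrier (Obj Y (n + 1))" using x by simp
    ultimately show "\<exists>x\<in>carrier (Obj X n). Diff X n x = \<one>\<^bsub>Obj X (n - 1)\<^esub> \<and>
       (\<exists>w\<in>carrier (Obj Y (n + 1)). y = g n x \<otimes>\<^bsub>Obj Y n\<^esub> Diff Y (n + 1) w)"
      using x by blast
  qed
qed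

lemma homology_inj_homotopic:
  assumes X: "X \<in> chain_complexes" and Y: "Y \<in> chain_complexes"
    and rel: "(f, g) \<in> homotopy_rel X Y" and f: "homology_inj X Y f"
  shows "homology_inj X Y g"
proof -
  obtain h where h: "homotopy X Y h f g" "g \<in> chain_maps X Y"
    using rel by (auto simp: homotopy_rel_iff[OF X Y])
  interpret g: chain_map X Y g using X Y h by unfold_locales
  interpret h: graded_map X Y 1 h using h by (simp add: homotopy_def)
  show ?thesis
    unfolding homology_inj_def
  proof (intro allI ballI impI)
    fix n x assume x: "x \<in> carrier (Obj X n)" "Diff X n x = \<one>\<^bsub>Obj X (n - 1)\<^esub>"
      and "\<exists>w\<in>carrier (Obj Y (n + 1)). Diff Y (n + 1) w = g n x"
    then obtain w where w: "w \<in> carrier (Obj Y (n + 1))" "Diff Y (n + 1) w = g n x" by blast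
    have "f n x = g n x \<otimes>\<^bsub>Obj Y n\<^esub> Diff Y (n + 1) (h n x)"
      using h x by (simp add: homotopy_def)
    then have "Diff Y (n + 1) (w \<otimes>\<^bsub>Obj Y (n + 1)\<^esub> h n x) = f n x" using x w by simp
    moreover have "w \<otimes>\<^bsub>Obj Y (n + 1)\<^esub> h n x \<in> carrier (Obj Y (n + 1))" using x w by simp
    ultimately show "\<exists>w\<in>carrier (Obj X (n + 1)). Diff X (n + 1) w = x"
      using homology_injE[OF f x] by metis
  qed
qed

lemma homology_surj_comp:
  assumes "chain_map X Y f" "chain_map Y Z g" "homology_surj X Y f" "homology_surj Y Z g"
  shows "homology_surj X Z (chain_comp X g f)"
proof -
  interpret f: chain_map X Y f by fact
  interpret g: chain_map Y Z g by fact
  show ?thesis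
    unfolding homology_surj_def
  proof (intro allI ballI impI)
    fix n z assume "z \<in> carrier (Obj Z n)" "Diff Z n z = \<one>\<^bsub>Obj Z (n - 1)\<^esub>"
    with assms(4) obtain y w where y: "y \<in> carrier (Obj Y n)" "Diff Y n y = \<one>\<^bsub>Obj Y (n - 1)\<^esub>"
      "w \<in> carrier (Obj Z (n + 1))" "z = g n y \<otimes>\<^bsub>Obj Z n\<^esub> Diff Z (n + 1) w"
      by (rule homology_surjE)
    from assms(3) y(1,2) obtain x v where x: "x \<in> carrier (Obj X n)" "Diff X n x = \<one>\<^bsub>Obj X (n - 1)\<^esub>"
      "v \<in> carrier (Obj Y (n + 1))" "y = f n x \<otimes>\<^bsub>Obj Y n\<^esub> Diff Y (n + 1) v"
      by (rule homology_surjE)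
    have "z = chain_comp X g f n x \<otimes>\<^bsub>Obj Z n\<^esub> Diff Z (n + 1) (g (n + 1) v \<otimes>\<^bsub>Obj Z (n + 1)\<^esub> w)"
      using x y(3,4) by (simp add: g.diff_map g.Y.ob.m_assoc)
    moreover have "g (n + 1) v \<otimes>\<^bsub>Obj Z (n + 1)\<^esub> w \<in> carrier (Obj Z (n + 1))" using x y by simp
    ultimately show "\<exists>x\<in>carrier (Obj X n). Diff X n x = \<one>\<^bsub>Obj X (n - 1)\<^esub> \<and>
       (\<exists>w\<in>carrier (Obj Z (n + 1)). z = chain_comp X g f n x \<otimes>\<^bsub>Obj Z n\<^esub> Diff Z (n + 1) w)"
      using x(1,2) by blast
  qed
qed

lemma homology_inj_comp:
  assumes "chain_map X Y f" "chain_map Y Z g" "homology_inj X Y f" "homology_inj Y Z g"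
  shows "homology_inj X Z (chain_comp X g f)"
proof -
  interpret f: chain_map X Y f by fact
  interpret g: chain_map Y Z g by fact
  show ?thesis
    unfolding homology_inj_def
  proof (intro allI ballI impI)
    fix n x assume x: "x \<in> carrier (Obj X n)" "Diff X n x = \<one>\<^bsub>Obj X (n - 1)\<^esub>"
      and "\<exists>w\<in>carrier (Obj Z (n + 1)). Diff Z (n + 1) w = chain_comp X g f n x"
    then obtain w where w: "w \<in> carrier (Obj Z (n + 1))" "Diff Z (n + 1) w = g n (f n x)" by auto
    have "f n x \<in> carrier (Obj Y n)" "Diff Y n (f n x) = \<one>\<^bsub>Obj Y (n - 1)\<^esub>"
      using x by (simp_all add: f.diff_map)
    then obtain v where "v \<in> carrier (Obj Y (n + 1))" "Diff Y (n + 1) v = f n x"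
      by (rule homology_injE[OF assms(4) _ _ w])
    then show "\<exists>w\<in>carrier (Obj X (n + 1)). Diff X (n + 1) w = x"
      using homology_injE[OF assms(3) x] by metis
  qed
qed

lemma homology_surj_comp_cancel:
  assumes "chain_map X Y f" "chain_map Y Z g" "homology_surj X Z (chain_comp X g f)"
  shows "homology_surj Y Z g"
proof -
  interpret f: chain_map X Y f by fact
  interpret g: chain_map Y Z g by fact
  show ?thesis
    unfolding homology_surj_def
  proof (intro allI ballI impI)
    fix n z assume "z \<in> carrier (Obj Z n)" "Diff Z n z = \<one>\<^bsub>Obj Z (n - 1)\<^esub>"
    with assms(3) obtain x w where x: "x \<in> carrier (Obj X n)" "Diff X n x = \<one>\<^bsub>Obj X (n - 1)\<^esub>"
      "w \<in> carrier (Obj Z (n + 1))" "z = chain_comp X g f n x \<otimes>\<^bsub>Obj Z n\<^esub> Diff Z (n + 1) w"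
      by (rule homology_surjE)
    then show "\<exists>x\<in>carrier (Obj Y n). Diff Y n x = \<one>\<^bsub>Obj Y (n - 1)\<^esub> \<and>
       (\<exists>w\<in>carrier (Obj Z (n + 1)). z = g n x \<otimes>\<^bsub>Obj Z n\<^esub> Diff Z (n + 1) w)"
      by (intro bexI[of _ "f n x"]) (auto simp: f.diff_map)
  qed
qed

lemma homology_inj_comp_cancel:
  assumes "chain_map X Y f" "chain_map Y Z g" "homology_inj X Z (chain_comp X g f)"
  shows "homology_inj X Y f"
proof -
  interpret f: chain_map X Y f by fact
  interpret g: chain_map Y Z g by fact
  show ?thesis
    unfolding homology_inj_def
  proof (intro allI ballI impI)
    fix n x assume x: "x \<in> carrier (Obj X n)" "Diff X n x = \<one>\<^bsub>Obj X (n - 1)\<^esub>"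
      and "\<exists>w\<in>carrier (Obj Y (n + 1)). Diff Y (n + 1) w = f n x"
    then obtain w where w: "w \<in> carrier (Obj Y (n + 1))" "Diff Y (n + 1) w = f n x" by blast
    then have "g (n + 1) w \<in> carrier (Obj Z (n + 1))"
        "Diff Z (n + 1) (g (n + 1) w) = chain_comp X g f n x"
      using x by (simp_all add: g.diff_map)
    then show "\<exists>w\<in>carrier (Obj X (n + 1)). Diff X (n + 1) w = x"
      using homology_injE[OF assms(3) x] by metis
  qed
qed

lemma chain_id_homology:
  assumes "X \<in> chain_complexes"
  shows "homology_surj X X (chain_id X)" "homology_inj X X (chain_id X)"
proof -
  interpret complex X using assms by unfold_locales
  show "homology_inj X X (chain_id X)" by (simp add: homology_inj_def chain_id_def)
  show "homology_surj X X (chain_id X)"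
    unfolding homology_surj_def
  proof (intro allI ballI impI)
    fix n x assume "x \<in> carrier (Obj X n)" "Diff X n x = \<one>\<^bsub>Obj X (n - 1)\<^esub>"
    then show "\<exists>y\<in>carrier (Obj X n). Diff X n y = \<one>\<^bsub>Obj X (n - 1)\<^esub> \<and>
       (\<exists>w\<in>carrier (Obj X (n + 1)). x = chain_id X n y \<otimes>\<^bsub>Obj X n\<^esub> Diff X (n + 1) w)"
      by (intro bexI[of _ x] conjI bexI[of _ "\<one>\<^bsub>Obj X (n + 1)\<^esub>"]) (simp_all add: chain_id_def)
  qed
qed

lemma isosE:
  assumes a: "a \<in> isos homotopy_cat X Y" and X: "X \<in> chain_complexes" and Y: "Y \<in> chain_complexes"
  obtains f g where "f \<in> chain_maps X Y" "g \<in> chain_maps Y X" "a = hclass X Y f"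
    "(chain_id X, chain_comp X g f) \<in> homotopy_rel X X"
    "(chain_id Y, chain_comp Y f g) \<in> homotopy_rel Y Y"
proof -
  obtain f g where fg: "f \<in> chain_maps X Y" "g \<in> chain_maps Y X" "a = hclass X Y f"
    "Comp homotopy_cat X Y X (hclass Y X g) (hclass X Y f) = Id homotopy_cat X"
    "Comp homotopy_cat Y X Y (hclass X Y f) (hclass Y X g) = Id homotopy_cat Y"
    using a by (auto simp: isos_def Hom_homotopy_cat_iff)
  have "(chain_id X, chain_comp X g f) \<in> homotopy_rel X X"
    using fg X Y by (simp add: Comp_homotopy_cat Id_homotopy_cat hclass_eq_iff[symmetric]
        chain_comp_maps[OF X Y X] chain_id_maps)
  moreover have "(chain_id Y, chain_comp Y f g) \<in> homotopy_rel Y Y"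
    using fg X Y by (simp add: Comp_homotopy_cat Id_homotopy_cat hclass_eq_iff[symmetric]
        chain_comp_maps[OF Y X Y] chain_id_maps)
  ultimately show ?thesis using fg that by blast
qed

text \<open>
  If \<open>g f\<close> is homotopic to the identity, then it is bijective on homology, so \<open>f\<close> is injective and
  \<open>g\<close> surjective there. Used in both directions, this makes homotopy equivalences
  quasi-isomorphisms.
\<close>

lemma homotopy_inverse_homology:
  assumes X: "X \<in> chain_complexes" and Y: "Y \<in> chain_complexes"
    and f: "f \<in> chain_maps X Y" and g: "g \<in> chain_maps Y X"
    and gf: "(chain_id X, chain_comp X g f) \<in> homotopy_rel X X"
  shows "homology_inj X Y f" "homology_surj Y X g"
  using homology_inj_comp_cancel[OF chain_map_intro[OF X Y f] chain_map_intro[OF Y X g]]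
    homology_surj_comp_cancel[OF chain_map_intro[OF X Y f] chain_map_intro[OF Y X g]]
    homology_inj_homotopic[OF X X gf] homology_surj_homotopic[OF X X gf] chain_id_homology[OF X]
  by simp_all

lemma acyclic_homology_surj:
  assumes f: "chain_map X Y f" "homology_surj X Y f" and X: "X \<in> acyclic_complexes"
  shows "Y \<in> acyclic_complexes"
proof -
  interpret f: chain_map X Y f by fact
  have "\<exists>v\<in>carrier (Obj Y (n + 1)). Diff Y (n + 1) v = y"
    if "y \<in> carrier (Obj Y n)" "Diff Y n y = \<one>\<^bsub>Obj Y (n - 1)\<^esub>" for n y
  proof -
    from f(2) that obtain x w where x: "x \<in> carrier (Obj X n)" "Diff X n x = \<one>\<^bsub>Obj X (n - 1)\<^esub>"
      "w \<in> carrier (Obj Y (n + 1))" "y = f n x \<otimes>\<^bsub>Obj Y n\<^esub> Diff Y (n + 1) w"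
      by (rule homology_surjE)
    obtain v where v: "v \<in> carrier (Obj X (n + 1))" "Diff X (n + 1) v = x"
      using X x unfolding acyclic_complexes_def by blast
    then show ?thesis
      using x by (intro bexI[of _ "f (n + 1) v \<otimes>\<^bsub>Obj Y (n + 1)\<^esub> w"]) (simp_all add: f.diff_map)
  qed
  then show ?thesis using f.Y.complex by (simp add: acyclic_complexes_def)
qed

context chain_map
begin

text \<open>
  For a cycle \<open>(x, y)\<close> of the cone, \<open>d y = - f x\<close>, so \<open>f x\<close> is a boundary and injectivity gives
  \<open>x = d w\<close>. Then \<open>y + f w\<close> is a cycle and surjectivity gives \<open>y + f w = f v + d u\<close> for a cycle
  \<open>v\<close>. Therefore \<open>(x, y) = d (v - w, u)\<close>.
\<close>

lemma cone_acyclic: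
  assumes surj: "homology_surj X Y f" and inj: "homology_inj X Y f"
  shows "cone X Y f \<in> acyclic_complexes"
proof -
  have "\<exists>q\<in>carrier (Obj (cone X Y f) (n + 1)). Diff (cone X Y f) (n + 1) q = p"
    if p: "p \<in> carrier (Obj (cone X Y f) n)"
      and d: "Diff (cone X Y f) n p = \<one>\<^bsub>Obj (cone X Y f) (n - 1)\<^esub>" for n p
  proof -
    obtain x y where xy: "p = opair x y" "x \<in> carrier (Obj X (n - 1))" "y \<in> carrier (Obj Y n)"
      using p unfolding Obj_cone by (rule dsumE)
    have x: "Diff X (n - 1) x = \<one>\<^bsub>Obj X (n - 2)\<^esub>"
      and y: "f (n - 1) x \<otimes>\<^bsub>Obj Y (n - 1)\<^esub> Diff Y n y = \<one>\<^bsub>Obj Y (n - 1)\<^esub>"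
      using d xy by simp_all
    have "Diff Y n (inv\<^bsub>Obj Y n\<^esub> y) = f (n - 1) x"
      using y xy by (simp add: Y.ob.inv_equality)
    then obtain w where w: "w \<in> carrier (Obj X n)" "Diff X n w = x"
      using homology_injE[OF inj xy(2), of "inv\<^bsub>Obj Y n\<^esub> y"] x xy by auto
    have "Diff Y n (y \<otimes>\<^bsub>Obj Y n\<^esub> f n w) = \<one>\<^bsub>Obj Y (n - 1)\<^esub>"
      using xy w y by (simp add: diff_map Y.ob.m_comm)
    then obtain v u where v: "v \<in> carrier (Obj X n)" "Diff X n v = \<one>\<^bsub>Obj X (n - 1)\<^esub>"
      "u \<in> carrier (Obj Y (n + 1))" "y \<otimes>\<^bsub>Obj Y n\<^esub> f n w = f n v \<otimes>\<^bsub>Obj Y n\<^esub> Diff Y (n + 1) u"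
      using xy w by (elim homology_surjE[OF surj, rotated]) auto
    have "y = (f n v \<otimes>\<^bsub>Obj Y n\<^esub> Diff Y (n + 1) u) \<otimes>\<^bsub>Obj Y n\<^esub> inv\<^bsub>Obj Y n\<^esub> f n w"
      using v xy w by (simp add: Y.ob.inv_solve_right)
    then have "f n (v \<otimes>\<^bsub>Obj X n\<^esub> inv\<^bsub>Obj X n\<^esub> w) \<otimes>\<^bsub>Obj Y n\<^esub> Diff Y (n + 1) u = y"
      using v w by (simp add: Y.ob.m_ac)
    then show ?thesis
      using v w xy
      by (intro bexI[of _ "opair (v \<otimes>\<^bsub>Obj X n\<^esub> inv\<^bsub>Obj X n\<^esub> w) u"]) simp_all
  qed
  then show ?thesis using cone_complex by (simp add: acyclic_complexes_def)
qed

text \<open>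
  Surjectivity: for a cycle \<open>y\<close> of \<open>Y\<close>, the cycle \<open>(0, y)\<close> of the cone is a boundary. Injectivity:
  if \<open>f x = d w\<close> for a cycle \<open>x\<close>, the cycle \<open>(x, - w)\<close> of the cone is a boundary.
\<close>

lemma acyclic_cone_homology:
  assumes ac: "cone X Y f \<in> acyclic_complexes"
  shows "homology_surj X Y f" "homology_inj X Y f"
proof -
  have boundary: "\<exists>x'\<in>carrier (Obj X n). \<exists>y'\<in>carrier (Obj Y (n + 1)).
      inv\<^bsub>Obj X (n - 1)\<^esub> Diff X n x' = x \<and> f n x' \<otimes>\<^bsub>Obj Y n\<^esub> Diff Y (n + 1) y' = y"
    if x: "x \<in> carrier (Obj X (n - 1))" "Diff X (n - 1) x = \<one>\<^bsub>Obj X (n - 2)\<^esub>"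
      and y: "y \<in> carrier (Obj Y n)" "f (n - 1) x \<otimes>\<^bsub>Obj Y (n - 1)\<^esub> Diff Y n y = \<one>\<^bsub>Obj Y (n - 1)\<^esub>"
    for n x y
  proof -
    have "\<exists>q\<in>carrier (Obj (cone X Y f) (n + 1)). Diff (cone X Y f) (n + 1) q = opair x y"
      using ac x y unfolding acyclic_complexes_def by simp
    then obtain q where q: "q \<in> carrier (dsum (Obj X n) (Obj Y (n + 1)))"
      "Diff (cone X Y f) (n + 1) q = opair x y"
      by auto
    from q(1) obtain x' y' where "q = opair x' y'" "x' \<in> carrier (Obj X n)" "y' \<in> carrier (Obj Y (n + 1))"
      by (rule dsumE)
    then show ?thesis using q(2) by (intro bexI[of _ x'] bexI[of _ y']) simp_all
  qed
  show "homology_surj X Y f"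
    unfolding homology_surj_def
  proof (intro allI ballI impI)
    fix n y assume y: "y \<in> carrier (Obj Y n)" "Diff Y n y = \<one>\<^bsub>Obj Y (n - 1)\<^esub>"
    obtain x w where x: "x \<in> carrier (Obj X n)" "w \<in> carrier (Obj Y (n + 1))"
      "inv\<^bsub>Obj X (n - 1)\<^esub> Diff X n x = \<one>\<^bsub>Obj X (n - 1)\<^esub>" "f n x \<otimes>\<^bsub>Obj Y n\<^esub> Diff Y (n + 1) w = y"
      using boundary[of "\<one>\<^bsub>Obj X (n - 1)\<^esub>" n y] y by auto
    then have "Diff X n x = \<one>\<^bsub>Obj X (n - 1)\<^esub>"
      using X.ob.inv_eq_1_iff by simp
    then show "\<exists>x\<in>carrier (Obj X n). Diff X n x = \<one>\<^bsub>Obj X (n - 1)\<^esub> \<and>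
       (\<exists>w\<in>carrier (Obj Y (n + 1)). y = f n x \<otimes>\<^bsub>Obj Y n\<^esub> Diff Y (n + 1) w)"
      using x by blast
  qed
  show "homology_inj X Y f"
    unfolding homology_inj_def
  proof (intro allI ballI impI)
    fix n x assume x: "x \<in> carrier (Obj X n)" "Diff X n x = \<one>\<^bsub>Obj X (n - 1)\<^esub>"
      and "\<exists>w\<in>carrier (Obj Y (n + 1)). Diff Y (n + 1) w = f n x"
    then obtain w where w: "w \<in> carrier (Obj Y (n + 1))" "Diff Y (n + 1) w = f n x" by blast
    obtain v where "v \<in> carrier (Obj X (n + 1))" "inv\<^bsub>Obj X n\<^esub> Diff X (n + 1) v = x"
      using boundary[of x "n + 1" "inv\<^bsub>Obj Y (n + 1)\<^esub> w"] x w by auto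
    then show "\<exists>w\<in>carrier (Obj X (n + 1)). Diff X (n + 1) w = x"
      by (intro bexI[of _ "inv\<^bsub>Obj X (n + 1)\<^esub> v"]) simp_all
  qed
qed

end

section \<open>The morphisms inverted in the derived category\<close>

lemma Hom_K_A [simp]: "Hom K_A = Hom homotopy_cat"
  and Ob_K_A [simp]: "Ob K_A = chain_complexes"
  and Comp_K_A [simp]: "Comp K_A = Comp homotopy_cat"
  and Susp_K_A [simp]: "Susp K_A = suspension"
  and Dist_K_A [simp]: "Dist K_A = distinguished"
  by (simp_all add: K_A_def cat.extend_def homotopy_cat_def)

lemma quasi_iso_inverted:
  assumes "chain_map X Y f" "homology_surj X Y f" "homology_inj X Y f"
  shows "hclass X Y f \<in> verdier_mor K_A acyclic_complexes X Y"
proof -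
  interpret chain_map X Y f by fact
  show ?thesis
    unfolding verdier_mor_def
    using cone_acyclic[OF assms(2,3)] cone_triangle_distinguished hclass_in_Hom[OF chain_map] by auto
qed

text \<open>
  The triangle of \<open>t\<close> is isomorphic to the cone triangle of a chain map \<open>F\<close>. The cone of \<open>F\<close> is
  acyclic, being homotopy equivalent to the acyclic third object, so \<open>F\<close> is a quasi-isomorphism. The
  commuting square expresses \<open>t\<close> as the composite of \<open>F\<close> with homotopy equivalences.
\<close>

lemma inverted_quasi_iso:
  assumes t: "t \<in> verdier_mor K_A acyclic_complexes X Y"
  obtains f where "X \<in> chain_complexes" "Y \<in> chain_complexes" "f \<in> chain_maps X Y"
    "t = hclass X Y f" "homology_surj X Y f" "homology_inj X Y f"
proof -
  obtain Z g h where Z: "Z \<in> acyclic_complexes" and dist: "(X, Y, Z, t, g, h) \<in> distinguished"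
    using t by (auto simp: verdier_mor_def)
  from dist obtain X' Y' Z' f' g' h' a b c where cxs: "X \<in> chain_complexes" "Y \<in> chain_complexes"
    "Z \<in> chain_complexes" and th: "t \<in> Hom homotopy_cat X Y"
    and tri: "(X', Y', Z', f', g', h') \<in> cone_triangles"
    and isos: "a \<in> isos homotopy_cat X X'" "b \<in> isos homotopy_cat Y Y'" "c \<in> isos homotopy_cat Z Z'"
    and sq: "Comp homotopy_cat X Y Y' b t = Comp homotopy_cat X X' Y' f' a"
    unfolding distinguished_def by blast
  from tri obtain F where F: "X' \<in> chain_complexes" "Y' \<in> chain_complexes" "F \<in> chain_maps X' Y'"
    "Z' = cone X' Y' F" "f' = hclass X' Y' F"
    by (auto simp: cone_triangles_def)
  interpret F: chain_map X' Y' F using F by unfold_locales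
  obtain C where C: "C \<in> chain_maps Z (cone X' Y' F)" "homology_surj Z (cone X' Y' F) C"
    using isosE[OF isos(3)] homotopy_inverse_homology(2) cxs F.cone_complex unfolding F by metis
  have "cone X' Y' F \<in> acyclic_complexes"
    using acyclic_homology_surj[OF chain_map_intro[OF cxs(3) F.cone_complex C(1)] C(2) Z] .
  note hF = F.acyclic_cone_homology[OF this]
  obtain A where A: "A \<in> chain_maps X X'" "a = hclass X X' A" "homology_surj X X' A" "homology_inj X X' A"
    using isosE[OF isos(1)] homotopy_inverse_homology cxs F by metis
  obtain B B' where B: "B \<in> chain_maps Y Y'" "B' \<in> chain_maps Y' Y" "b = hclass Y Y' B"
    "(chain_id Y, chain_comp Y B' B) \<in> homotopy_rel Y Y"
    "homology_surj Y' Y B'" "homology_inj Y' Y B'"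
    using isosE[OF isos(2)] homotopy_inverse_homology cxs F by metis
  obtain T where T: "T \<in> chain_maps X Y" "t = hclass X Y T"
    using th by (auto simp: Hom_homotopy_cat_iff)
  \<comment> \<open>With \<open>B'\<close> a homotopy inverse of \<open>B\<close>, the square gives \<open>T \<simeq> B' B T \<simeq> B' F A\<close>.\<close>
  have assoc: "chain_comp X (chain_comp Y B' B) T = chain_comp X B' (chain_comp X B T)"
  proof -
    interpret T: chain_map X Y T using cxs T by unfold_locales
    show ?thesis
      using cxs F T B
      by (intro chain_maps_eqI[of _ X Y] chain_comp_maps[of _ Y] chain_comp_maps[of _ Y']) simp_all
  qed
  have FA: "chain_map X Y' (chain_comp X F A)"
    using cxs F A by (intro chain_map_intro chain_comp_maps[of _ X'])
  have "(chain_comp X B T, chain_comp X F A) \<in> homotopy_rel X Y'"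
    using sq cxs F A B T
    by (simp add: Comp_homotopy_cat hclass_eq_iff[symmetric] chain_comp_maps[of _ Y]
        chain_comp_maps[of _ X'])
  then have 1: "(chain_comp X B' (chain_comp X B T), chain_comp X B' (chain_comp X F A)) \<in> homotopy_rel X Y"
    using cxs F B equiv_class_self[OF homotopy_equiv, of Y' Y B']
    by (intro chain_comp_homotopic[of X Y' Y "chain_comp X B T" "chain_comp X F A" B' B']) auto
  have 2: "(T, chain_comp X B' (chain_comp X B T)) \<in> homotopy_rel X Y"
    using chain_comp_homotopic[OF cxs(1,2,2) _ B(4), of T T] cxs T
      equiv_class_self[OF homotopy_equiv, of X Y T]
    by (simp add: chain_comp_id_left assoc)
  have rel: "(chain_comp X B' (chain_comp X F A), T) \<in> homotopy_rel X Y"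
    using homotopy_equiv[OF cxs(1,2)] 1 2 unfolding equiv_def by (meson symD transD)
  have mA: "chain_map X X' A" and mB: "chain_map Y' Y B'"
    using cxs F A B by (auto intro: chain_map_intro)
  have "homology_surj X Y T"
    using homology_surj_homotopic[OF cxs(1,2) rel] homology_surj_comp[OF FA mB]
      homology_surj_comp[OF mA F.chain_map_axioms] A B hF by simp
  moreover have "homology_inj X Y T"
    using homology_inj_homotopic[OF cxs(1,2) rel] homology_inj_comp[OF FA mB]
      homology_inj_comp[OF mA F.chain_map_axioms] A B hF by simp
  ultimately show ?thesis using that cxs T by blast
qed

section \<open>Modules in degree zero and short exact sequences\<close>

lemma zero_rmodule_simps [simp]:
  "carrier zero_rmodule = {vset {}}" "\<one>\<^bsub>zero_rmodule\<^esub> = vset {}"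
  "x \<otimes>\<^bsub>zero_rmodule\<^esub> y = vset {}" "act zero_rmodule i x = vset {}"
  by (simp_all add: zero_rmodule_def)

lemma zero_rmodule: "zero_rmodule \<in> rmodules"
proof -
  have "comm_group zero_rmodule" by (rule comm_groupI) auto
  moreover have "elts (vset {vset {}}) = carrier zero_rmodule" by simp
  ultimately show ?thesis unfolding rmodules_def by (auto simp: hom_def simp del: elts_vset_singleton)
qed

lemma Obj_in_degree_zero: "Obj (in_degree_zero M) n = (if n = 0 then M else zero_rmodule)"
  by (simp add: in_degree_zero_def Let_def)

lemma Diff_in_degree_zero [simp]:
  "x \<in> carrier (Obj (in_degree_zero M) n) \<Longrightarrow> Diff (in_degree_zero M) n x = \<one>\<^bsub>Obj (in_degree_zero M) (n - 1)\<^esub>"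
  by (simp add: in_degree_zero_def Let_def)

lemma in_degree_zero_complex:
  assumes M: "M \<in> rmodules"
  shows "in_degree_zero M \<in> chain_complexes" (is "?X \<in> _")
proof -
  have obj: "Obj ?X n \<in> rmodules" for n using M by (simp add: Obj_in_degree_zero zero_rmodule)
  interpret ob: comm_group "Obj ?X n" for n using obj by (rule rmodule_comm_group)
  have "(\<lambda>x\<in>carrier (Obj ?X n). \<one>\<^bsub>Obj ?X (n - 1)\<^esub>) \<in> rhom (Obj ?X n) (Obj ?X (n - 1))" for n
    by (intro rhomI obj) (simp_all add: act_one[OF obj])
  then have "Diff ?X n \<in> rhom (Obj ?X n) (Obj ?X (n - 1))" for n
    by (simp add: in_degree_zero_def Let_def)
  then show ?thesis using obj by (simp add: chain_complexes_def)
qed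

text \<open>
  The underlying set of the zero module is \<open>{vset {}}\<close>, and outside degree zero the map is its
  extensional identity.
\<close>

definition degree_zero_map :: "('u::universe \<Rightarrow> 'u) \<Rightarrow> int \<Rightarrow> 'u \<Rightarrow> 'u" where
  "degree_zero_map u n = (if n = 0 then u else (\<lambda>x\<in>{vset {}}. vset {}))"

lemma degree_zero_chain_map:
  fixes M N :: "'u::universe rmodule"
  assumes M: "M \<in> rmodules" and N: "N \<in> rmodules" and u: "u \<in> rhom M N"
  shows "degree_zero_map u \<in> chain_maps (in_degree_zero M) (in_degree_zero N)"
proof (rule chain_mapsI)
  have "(\<lambda>x\<in>carrier zero_rmodule. vset {}) \<in> rhom (zero_rmodule :: 'u rmodule) zero_rmodule"
    by (rule rhomI[OF zero_rmodule]) simp_all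
  then show deg: "degree_zero_map u n \<in> rhom (Obj (in_degree_zero M) n) (Obj (in_degree_zero N) n)" for n
    using u by (simp add: degree_zero_map_def Obj_in_degree_zero)
  fix n x assume x: "x \<in> carrier (Obj (in_degree_zero M) n)"
  interpret X: complex "in_degree_zero M" using in_degree_zero_complex[OF M] by unfold_locales
  interpret Y: complex "in_degree_zero N" using in_degree_zero_complex[OF N] by unfold_locales
  show "Diff (in_degree_zero N) n (degree_zero_map u n x) =
      degree_zero_map u (n - 1) (Diff (in_degree_zero M) n x)"
    using x rhom_closed[OF deg x] rhom_one[OF deg X.obj Y.obj] by simp
qed

text \<open>
  All differentials of the target vanish, so a homotopy contributes nothing on a cycle.
\<close>

lemma homotopic_degree_zero_eq_on_cycles:
  assumes V: "V \<in> chain_complexes" and M: "M \<in> rmodules"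
    and rel: "(f, g) \<in> homotopy_rel V (in_degree_zero M)"
    and v: "v \<in> carrier (Obj V n)" "Diff V n v = \<one>\<^bsub>Obj V (n - 1)\<^esub>"
  shows "f n v = g n v"
proof -
  note Y = in_degree_zero_complex[OF M]
  obtain h where h: "homotopy V (in_degree_zero M) h f g" "g \<in> chain_maps V (in_degree_zero M)"
    using rel by (auto simp: homotopy_rel_iff[OF V Y])
  interpret g: chain_map V "in_degree_zero M" g using V Y h by unfold_locales
  interpret h: graded_map V "in_degree_zero M" 1 h using h by (simp add: homotopy_def)
  show ?thesis using h(1) v by (simp add: homotopy_def)
qed

text \<open>
  Exactness is phrased by kernels and images of the homomorphisms. An exact sequence
  \<open>0 \<rightarrow> A \<rightarrow> B \<rightarrow> C \<rightarrow> 0\<close> yields the roof \<open>C \<leftarrow> cone (A \<rightarrow> B) \<rightarrow> \<Sigma>A\<close>, which represents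
  its class in \<open>Ext\<^sup>1 (C, A)\<close>.
\<close>

locale short_exact =
  fixes A B C :: "'u::universe rmodule" and \<iota> \<pi> :: "'u \<Rightarrow> 'u"
  assumes A: "A \<in> rmodules" and B: "B \<in> rmodules" and C: "C \<in> rmodules"
    and \<iota>: "\<iota> \<in> rhom A B" and \<pi>: "\<pi> \<in> rhom B C"
    and \<iota>_inj: "a \<in> carrier A \<Longrightarrow> \<iota> a = \<one>\<^bsub>B\<^esub> \<Longrightarrow> a = \<one>\<^bsub>A\<^esub>"
    and \<pi>_surj: "c \<in> carrier C \<Longrightarrow> \<exists>b\<in>carrier B. \<pi> b = c"
    and \<pi>_\<iota>: "a \<in> carrier A \<Longrightarrow> \<pi> (\<iota> a) = \<one>\<^bsub>C\<^esub>"
    and exact: "b \<in> carrier B \<Longrightarrow> \<pi> b = \<one>\<^bsub>C\<^esub> \<Longrightarrow> \<exists>a\<in>carrier A. \<iota> a = b"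
begin

abbreviation "A0 \<equiv> in_degree_zero A"
abbreviation "B0 \<equiv> in_degree_zero B"
abbreviation "C0 \<equiv> in_degree_zero C"

definition resolution :: "'u chain_complex" where
  "resolution = cone A0 B0 (degree_zero_map \<iota>)"

definition augmentation :: "int \<Rightarrow> 'u \<Rightarrow> 'u" where
  "augmentation n = (\<lambda>p\<in>carrier (Obj resolution n). degree_zero_map \<pi> n (osnd p))"

sublocale incl: chain_map A0 B0 "degree_zero_map \<iota>"
  using A B \<iota> by (intro chain_map_intro in_degree_zero_complex degree_zero_chain_map)

sublocale proj: chain_map B0 C0 "degree_zero_map \<pi>"
  using B C \<pi> by (intro chain_map_intro in_degree_zero_complex degree_zero_chain_map)

lemma Obj_resolution [simp]: "Obj resolution n = dsum (Obj A0 (n - 1)) (Obj B0 n)"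
  by (simp add: resolution_def)

lemma Diff_resolution [simp]:
  "x \<in> carrier (Obj A0 (n - 1)) \<Longrightarrow> y \<in> carrier (Obj B0 n) \<Longrightarrow>
    Diff resolution n (opair x y) = opair \<one>\<^bsub>Obj A0 (n - 2)\<^esub> (degree_zero_map \<iota> (n - 1) x)"
  by (simp add: resolution_def)

lemma augmentation_apply [simp]:
  "x \<in> carrier (Obj A0 (n - 1)) \<Longrightarrow> y \<in> carrier (Obj B0 n) \<Longrightarrow>
    augmentation n (opair x y) = degree_zero_map \<pi> n y"
  by (simp add: augmentation_def)

text \<open>
  Outside degree zero the sequence consists of zero modules, so exactness holds in every degree and
  the proofs below need no case distinction on the degree.
\<close>

lemma degreewise_exact:
  shows "a \<in> carrier (Obj A0 n) \<Longrightarrow> degree_zero_map \<iota> n a = \<one>\<^bsub>Obj B0 n\<^esub> \<Longrightarrow> a = \<one>\<^bsub>Obj A0 n\<^esub>"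
    and "c \<in> carrier (Obj C0 n) \<Longrightarrow> \<exists>b\<in>carrier (Obj B0 n). degree_zero_map \<pi> n b = c"
    and "a \<in> carrier (Obj A0 n) \<Longrightarrow> degree_zero_map \<pi> n (degree_zero_map \<iota> n a) = \<one>\<^bsub>Obj C0 n\<^esub>"
    and "b \<in> carrier (Obj B0 n) \<Longrightarrow> degree_zero_map \<pi> n b = \<one>\<^bsub>Obj C0 n\<^esub> \<Longrightarrow>
      \<exists>a\<in>carrier (Obj A0 n). degree_zero_map \<iota> n a = b"
  using \<iota>_inj \<pi>_surj \<pi>_\<iota> exact by (auto simp: Obj_in_degree_zero degree_zero_map_def split: if_splits)

lemma resolution_complex: "resolution \<in> chain_complexes"
  unfolding resolution_def by (rule incl.cone_complex)

lemma augmentation_map: "augmentation \<in> chain_maps resolution C0"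
proof (rule chain_mapsI)
  fix n
  show "augmentation n \<in> rhom (Obj resolution n) (Obj C0 n)"
    unfolding augmentation_def
    by (intro rhomI) (auto elim!: dsumE simp: dsum_rmodule proj.act)
next
  fix n p assume "p \<in> carrier (Obj resolution n)"
  then obtain x y where p: "p = opair x y" "x \<in> carrier (Obj A0 (n - 1))" "y \<in> carrier (Obj B0 n)"
    unfolding Obj_resolution by (rule dsumE)
  then show "Diff C0 n (augmentation n p) = augmentation (n - 1) (Diff resolution n p)"
    by (simp add: degreewise_exact(3))
qed

text \<open>
  All differentials of \<open>C\<close> vanish, so only two things matter. An element \<open>c = \<pi> b\<close> lifts to the cycle
  \<open>(0, b)\<close>. A cycle \<open>(a, b)\<close> with \<open>\<pi> b = 0\<close> has \<open>a = 0\<close>, since \<open>\<iota> a = 0\<close>, and \<open>b = \<iota> a'\<close>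
  for some \<open>a'\<close>, so it is the boundary of \<open>(a', 0)\<close>.
\<close>

lemma augmentation_quasi_iso:
  shows "homology_surj resolution C0 augmentation" "homology_inj resolution C0 augmentation"
proof -
  show "homology_surj resolution C0 augmentation"
    unfolding homology_surj_def
  proof (intro allI ballI impI)
    fix n c assume "c \<in> carrier (Obj C0 n)"
    moreover from this obtain b where "b \<in> carrier (Obj B0 n)" "degree_zero_map \<pi> n b = c"
      using degreewise_exact(2) by blast
    ultimately show "\<exists>x\<in>carrier (Obj resolution n). Diff resolution n x = \<one>\<^bsub>Obj resolution (n - 1)\<^esub> \<and>
       (\<exists>w\<in>carrier (Obj C0 (n + 1)). c = augmentation n x \<otimes>\<^bsub>Obj C0 n\<^esub> Diff C0 (n + 1) w)"
      by (intro bexI[of _ "opair \<one>\<^bsub>Obj A0 (n - 1)\<^esub> b"] conjI bexI[of _ "\<one>\<^bsub>Obj C0 (n + 1)\<^esub>"]) simp_all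
  qed
  show "homology_inj resolution C0 augmentation"
    unfolding homology_inj_def
  proof (intro allI ballI impI)
    fix n p assume p: "p \<in> carrier (Obj resolution n)" "Diff resolution n p = \<one>\<^bsub>Obj resolution (n - 1)\<^esub>"
      and w: "\<exists>w\<in>carrier (Obj C0 (n + 1)). Diff C0 (n + 1) w = augmentation n p"
    obtain a b where ab: "p = opair a b" "a \<in> carrier (Obj A0 (n - 1))" "b \<in> carrier (Obj B0 n)"
      using p(1) unfolding Obj_resolution by (rule dsumE)
    have "a = \<one>\<^bsub>Obj A0 (n - 1)\<^esub>" using p ab by (intro degreewise_exact(1)) simp_all
    moreover have "degree_zero_map \<pi> n b = \<one>\<^bsub>Obj C0 n\<^esub>" using w ab by auto
    then obtain a' where "a' \<in> carrier (Obj A0 n)" "degree_zero_map \<iota> n a' = b"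
      using degreewise_exact(4) ab by blast
    ultimately show "\<exists>w\<in>carrier (Obj resolution (n + 1)). Diff resolution (n + 1) w = p"
      using ab by (intro bexI[of _ "opair a' \<one>\<^bsub>Obj B0 (n + 1)\<^esub>"]) simp_all
  qed
qed

definition extension_roof where
  "extension_roof = (resolution, hclass resolution C0 augmentation,
     hclass resolution (suspension A0) (cone_out A0 B0))"

lemma cone_out_resolution_map: "cone_out A0 B0 \<in> chain_maps resolution (suspension A0)"
  unfolding resolution_def by (rule incl.cone_out_map)

lemma extension_roof: "extension_roof \<in> roofs K_A acyclic_complexes C0 (suspension A0)"
  unfolding extension_roof_def roofs_def
  using resolution_complex hclass_in_Hom[OF cone_out_resolution_map]
    quasi_iso_inverted[OF chain_map_intro[OF resolution_complex proj.Y.complex augmentation_map]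
      augmentation_quasi_iso]
  by simp

end

section \<open>The extension attached to an ordinal\<close>

lemma trivial_Z_simps [simp]:
  "carrier trivial_Z = range vint" "\<one>\<^bsub>trivial_Z\<^esub> = vint 0" "act trivial_Z i x = vint 0"
  "vint k \<otimes>\<^bsub>trivial_Z\<^esub> vint l = vint (k + l)"
  by (simp_all add: trivial_Z_def)

lemma trivial_Z_comm_group: "comm_group trivial_Z"
proof (rule comm_groupI)
  fix x assume "x \<in> carrier (trivial_Z :: 'a rmodule)"
  then obtain k where "x = vint k" by auto
  then show "\<exists>y\<in>carrier trivial_Z. y \<otimes>\<^bsub>trivial_Z\<^esub> x = \<one>\<^bsub>trivial_Z\<^esub>"
    by (intro bexI[of _ "vint (- k)"]) simp_all
qed auto

lemma trivial_Z_rmodule: "trivial_Z \<in> rmodules"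
  using trivial_Z_comm_group small_range_vint unfolding rmodules_def by (auto simp: hom_def)

definition ext_module :: "'u::universe \<Rightarrow> 'u rmodule" where
  "ext_module i = (dsum trivial_Z trivial_Z)\<lparr>act := (\<lambda>j p.
     opair (vint 0) (if j = i then ofst p else vint 0))\<rparr>"

lemma ext_module_simps [simp]:
  "carrier (ext_module i) = carrier (dsum trivial_Z trivial_Z)"
  "p \<otimes>\<^bsub>ext_module i\<^esub> q = p \<otimes>\<^bsub>dsum trivial_Z trivial_Z\<^esub> q"
  "\<one>\<^bsub>ext_module i\<^esub> = opair (vint 0) (vint 0)"
  "act (ext_module i) j p = opair (vint 0) (if j = i then ofst p else vint 0)"
  unfolding ext_module_def by (simp_all add: dsum_def)

lemma ext_module_rmodule: "ext_module (i :: 'u::universe) \<in> rmodules"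
proof -
  interpret D: comm_group "dsum trivial_Z trivial_Z"
    by (intro comm_group_dsum trivial_Z_comm_group)
  have "comm_group (ext_module i)"
  proof (rule comm_groupI)
    fix p assume p: "p \<in> carrier (ext_module i)"
    then show "\<exists>q\<in>carrier (ext_module i). q \<otimes>\<^bsub>ext_module i\<^esub> p = \<one>\<^bsub>ext_module i\<^esub>"
      using D.l_inv[of p] by (intro bexI[of _ "inv\<^bsub>dsum trivial_Z trivial_Z\<^esub> p"]) simp_all
  qed (use D.m_closed D.one_closed D.m_assoc D.m_comm D.l_one in auto)
  moreover have "dsum trivial_Z trivial_Z \<in> (rmodules :: 'u rmodule set)"
    by (rule dsum_rmodule[OF trivial_Z_rmodule trivial_Z_rmodule])
  then have "\<exists>m. elts m = carrier (ext_module i)" by (simp add: rmodules_def)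
  ultimately show ?thesis
    unfolding rmodules_def by (auto simp: hom_def elim!: dsumE)
qed

definition ext_incl :: "'u::universe \<Rightarrow> 'u" where
  "ext_incl = (\<lambda>x\<in>range vint. opair (vint 0) x)"

definition ext_proj :: "'u::universe \<Rightarrow> 'u" where
  "ext_proj = (\<lambda>p\<in>carrier (dsum trivial_Z trivial_Z). ofst p)"

lemma ext_short_exact: "short_exact trivial_Z (ext_module i) trivial_Z ext_incl ext_proj"
proof unfold_locales
  show "trivial_Z \<in> rmodules" "ext_module i \<in> rmodules"
    by (rule trivial_Z_rmodule ext_module_rmodule)+
  show "ext_incl \<in> rhom trivial_Z (ext_module i)"
    unfolding ext_incl_def trivial_Z_simps(1)[symmetric]
    by (rule rhomI[OF trivial_Z_rmodule]) auto
  show "ext_proj \<in> rhom (ext_module i) trivial_Z"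
    unfolding ext_proj_def ext_module_simps(1)[of i, symmetric]
    by (rule rhomI[OF ext_module_rmodule]) (auto elim!: dsumE)
  show "\<exists>p\<in>carrier (ext_module i). ext_proj p = c" if "c \<in> carrier trivial_Z" for c
    using that by (intro bexI[of _ "opair c (vint 0)"]) (auto simp: ext_proj_def)
qed (auto simp: ext_incl_def ext_proj_def carrier_dsum)

interpretation ext: short_exact trivial_Z "ext_module i" trivial_Z ext_incl ext_proj for i
  by (rule ext_short_exact)

abbreviation "Z0 \<equiv> in_degree_zero trivial_Z"

text \<open>
  The component of \<open>U v\<close> in the extension module is \<open>(1, b)\<close> for some \<open>b\<close>, and \<open>i\<close> takes it to
  \<open>(0, 1)\<close> or \<open>(0, 0)\<close>, according to whether \<open>i\<close> is \<open>k\<close>. This is the boundary of \<open>U w\<close>, and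
  the differential from degree one to degree zero is the inclusion of the submodule of all \<open>(0, c)\<close>,
  which recovers \<open>c\<close>.
\<close>

lemma boundary_of_scaled_unit:
  fixes i k :: "'u::universe"
  assumes i: "i \<in> ordinals" and V: "V \<in> chain_complexes"
    and U: "U \<in> chain_maps V (ext.resolution k)"
    and rel: "(chain_comp V (ext.augmentation k) U, T) \<in> homotopy_rel V Z0"
    and v: "v \<in> carrier (Obj V 0)" "Diff V 0 v = \<one>\<^bsub>Obj V (- 1)\<^esub>" "T 0 v = vint 1"
    and w: "w \<in> carrier (Obj V 1)" "Diff V 1 w = act (Obj V 0) i v"
  shows "cone_out Z0 (in_degree_zero (ext_module k)) 1 (U 1 w) = vint (if i = k then 1 else 0)"
proof -
  interpret U: chain_map V "ext.resolution k" U
    using V U ext.resolution_complex by (intro chain_map_intro)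
  have "U 0 v \<in> carrier (Obj (ext.resolution k) 0)" using v(1) by (rule U.closed) simp
  then obtain z m where Uv: "U 0 v = opair z m" "z \<in> carrier (Obj Z0 (- 1))"
    "m \<in> carrier (Obj (in_degree_zero (ext_module k)) 0)"
    unfolding ext.Obj_resolution by (auto elim: dsumE)
  have "chain_comp V (ext.augmentation k) U 0 v = T 0 v"
    using homotopic_degree_zero_eq_on_cycles[OF V trivial_Z_rmodule rel] v by simp
  then have "degree_zero_map ext_proj 0 m = vint 1" using Uv v by simp
  then have "ofst m = vint 1"
    using Uv by (simp add: degree_zero_map_def ext_proj_def Obj_in_degree_zero)
  then have act: "act (Obj (ext.resolution k) 0) i (U 0 v) =
      opair (vset {}) (opair (vint 0) (vint (if i = k then 1 else 0)))"
    using Uv by (simp add: Obj_in_degree_zero)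
  have "U 1 w \<in> carrier (Obj (ext.resolution k) 1)" using w(1) by (rule U.closed) simp
  then obtain c m' where Uw: "U 1 w = opair c m'" "c \<in> carrier (Obj Z0 0)"
    "m' \<in> carrier (Obj (in_degree_zero (ext_module k)) 1)"
    unfolding ext.Obj_resolution by (auto elim: dsumE)
  have "Diff (ext.resolution k) 1 (U 1 w) = act (Obj (ext.resolution k) 0) i (U 0 v)"
    using w v i by (simp add: U.diff_map U.act)
  then have "degree_zero_map ext_incl 0 c = opair (vint 0) (vint (if i = k then 1 else 0))"
    unfolding act using Uw by simp
  then have "c = vint (if i = k then 1 else 0)"
    using Uw by (simp add: degree_zero_map_def ext_incl_def Obj_in_degree_zero)
  then show ?thesis using Uw by (simp add: cone_out_def)
qed

text \<open>
  The unit of \<open>\<int>\<close> lifts along the quasi-isomorphism \<open>T\<close> to a cycle \<open>v\<close>, and \<open>\<phi>\<^sub>i v\<close> bounds some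
  \<open>w\<close>. The two maps to \<open>\<Sigma>\<int>\<close> are compared at \<open>w\<close>: their values are given by
  \<open>boundary_of_scaled_unit\<close>, and a homotopy between them vanishes there because \<open>\<phi>\<^sub>i\<close> acts as zero on
  \<open>\<int>\<close>.
\<close>

lemma extension_roofs_distinct:
  fixes i j :: "'u::universe"
  assumes i: "i \<in> ordinals"
    and rel: "(ext.extension_roof i, ext.extension_roof j) \<in> roof_rel K_A acyclic_complexes Z0 (suspension Z0)"
  shows "i = j"
proof -
  let ?W = "ext.resolution :: 'u \<Rightarrow> _" and ?s = "ext.augmentation :: 'u \<Rightarrow> _"
  let ?f = "\<lambda>k :: 'u. cone_out Z0 (in_degree_zero (ext_module k))"
  have Z0: "(Z0 :: 'u chain_complex) \<in> chain_complexes"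
    by (rule in_degree_zero_complex[OF trivial_Z_rmodule])
  note SZ0 = suspension_complex[OF Z0]
  obtain V t g u u' where Vtg: "(V, t, g) \<in> roofs K_A acyclic_complexes Z0 (suspension Z0)"
    and u: "u \<in> Hom homotopy_cat V (?W i)" "u' \<in> Hom homotopy_cat V (?W j)"
    and comp: "Comp homotopy_cat V (?W i) Z0 (hclass (?W i) Z0 (?s i)) u = t"
      "Comp homotopy_cat V (?W j) Z0 (hclass (?W j) Z0 (?s j)) u' = t"
      "Comp homotopy_cat V (?W i) (suspension Z0) (hclass (?W i) (suspension Z0) (?f i)) u = g"
      "Comp homotopy_cat V (?W j) (suspension Z0) (hclass (?W j) (suspension Z0) (?f j)) u' = g"
    using rel unfolding roof_rel_def ext.extension_roof_def by auto
  have V: "V \<in> chain_complexes" and t: "t \<in> verdier_mor K_A acyclic_complexes V Z0"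
    using Vtg by (auto simp: roofs_def)
  obtain T where T: "T \<in> chain_maps V Z0" "t = hclass V Z0 T"
    "homology_surj V Z0 T" "homology_inj V Z0 T"
    using inverted_quasi_iso[OF t] by metis
  obtain U U' where U: "U \<in> chain_maps V (?W i)" "u = hclass V (?W i) U"
    and U': "U' \<in> chain_maps V (?W j)" "u' = hclass V (?W j) U'"
    using u by (auto simp: Hom_homotopy_cat_iff)
  note W = ext.resolution_complex and s = ext.augmentation_map and f = ext.cone_out_resolution_map
  have rels: "(chain_comp V (?s i) U, T) \<in> homotopy_rel V Z0"
      "(chain_comp V (?s j) U', T) \<in> homotopy_rel V Z0"
      "(chain_comp V (?f i) U, chain_comp V (?f j) U') \<in> homotopy_rel V (suspension Z0)"
    using comp unfolding T(2) U(2) U'(2)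
    by (simp_all add: Comp_homotopy_cat V Z0 SZ0 W s f U U' T hclass_eq_iff[symmetric]
        chain_comp_maps[of _ "?W i"] chain_comp_maps[of _ "?W j"])
  interpret T: chain_map V Z0 T using V Z0 T by (intro chain_map_intro)
  obtain v where v: "v \<in> carrier (Obj V 0)" "Diff V 0 v = \<one>\<^bsub>Obj V (- 1)\<^esub>" "T 0 v = vint 1"
  proof -
    have "vint 1 \<in> carrier (Obj (Z0 :: 'u chain_complex) 0)" by (simp add: Obj_in_degree_zero)
    moreover from this have "Diff (Z0 :: 'u chain_complex) 0 (vint 1) = \<one>\<^bsub>Obj Z0 (0 - 1)\<^esub>" by simp
    ultimately obtain v z where "v \<in> carrier (Obj V 0)" "Diff V 0 v = \<one>\<^bsub>Obj V (0 - 1)\<^esub>"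
      "z \<in> carrier (Obj Z0 (0 + 1))" "vint 1 = T 0 v \<otimes>\<^bsub>Obj Z0 0\<^esub> Diff Z0 (0 + 1) z"
      by (rule homology_surjE[OF T(3)])
    then show ?thesis using that by simp
  qed
  obtain w where w: "w \<in> carrier (Obj V 1)" "Diff V 1 w = act (Obj V 0) i v"
  proof -
    have "act (Obj V 0) i v \<in> carrier (Obj V 0)" using act_closed[OF T.X.obj i] v by simp
    moreover have "Diff V 0 (act (Obj V 0) i v) = \<one>\<^bsub>Obj V (0 - 1)\<^esub>"
      using v i by (simp add: T.X.diff_act act_one)
    moreover have "\<one>\<^bsub>Obj Z0 1\<^esub> \<in> carrier (Obj (Z0 :: 'u chain_complex) (0 + 1))"
      "Diff Z0 (0 + 1) \<one>\<^bsub>Obj Z0 1\<^esub> = T 0 (act (Obj V 0) i v)"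
      using v i by (simp_all add: T.act Obj_in_degree_zero)
    ultimately obtain w where "w \<in> carrier (Obj V (0 + 1))" "Diff V (0 + 1) w = act (Obj V 0) i v"
      by (rule homology_injE[OF T(4)])
    then show ?thesis using that by simp
  qed
  have fU: "chain_comp V (?f i) U 1 w = vint 1"
    using boundary_of_scaled_unit[OF i V U(1) rels(1) v w] w by simp
  have fU': "chain_comp V (?f j) U' 1 w = vint (if i = j then 1 else 0)"
    using boundary_of_scaled_unit[OF i V U'(1) rels(2) v w] w by simp
  obtain h where h: "homotopy V (suspension Z0) h (chain_comp V (?f i) U) (chain_comp V (?f j) U')"
    using rels(3) by (auto simp: homotopy_rel_iff[OF V SZ0])
  interpret h: graded_map V "suspension Z0" 1 h using h by (simp add: homotopy_def)
  have "h 1 w \<in> carrier (Obj (suspension Z0) 2)" using w by simp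
  then have dh: "Diff (suspension Z0) (1 + 1) (h 1 w) = vint 0"
    using group.is_monoid[THEN monoid.inv_one, OF comm_group.axioms(2)[OF trivial_Z_comm_group]]
    by (simp add: suspension_def Obj_in_degree_zero)
  have hd: "h (1 - 1) (Diff V 1 w) = vint 0"
    using w(2) h.act[OF i v(1)] by (simp add: suspension_def Obj_in_degree_zero)
  have "chain_comp V (?f i) U 1 w = chain_comp V (?f j) U' 1 w \<otimes>\<^bsub>Obj (suspension Z0) 1\<^esub>
      (Diff (suspension Z0) (1 + 1) (h 1 w) \<otimes>\<^bsub>Obj (suspension Z0) 1\<^esub> h (1 - 1) (Diff V 1 w))"
    using h w(1) unfolding homotopy_def by blast
  also have "Obj (suspension Z0) 1 = trivial_Z" by (simp add: suspension_def Obj_in_degree_zero)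
  finally have "vint 1 = (vint (if i = j then 1 else 0) :: 'u)"
    unfolding fU fU' dh hd trivial_Z_simps by simp
  then show ?thesis by (simp split: if_splits)
qed

text \<open>
  Reflexivity suffices to turn equality of two classes into equivalence of their roofs.
\<close>

lemma roof_rel_refl:
  assumes r: "r \<in> roofs K_A acyclic_complexes X Y" and XY: "X \<in> chain_complexes" "Y \<in> chain_complexes"
  shows "(r, r) \<in> roof_rel K_A acyclic_complexes X Y"
proof -
  obtain W s f where W: "r = (W, s, f)" "W \<in> chain_complexes" "s \<in> Hom homotopy_cat W X"
    "f \<in> Hom homotopy_cat W Y"
    using r by (cases r) (auto simp: roofs_def verdier_mor_def)
  have "Id homotopy_cat W \<in> Hom homotopy_cat W W"
    using W(2) by (simp add: Id_homotopy_cat hclass_in_Hom chain_id_maps)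
  then have "\<exists>u\<in>Hom K_A W W. \<exists>u'\<in>Hom K_A W W.
        Comp K_A W W X s u = s \<and> Comp K_A W W X s u' = s \<and>
        Comp K_A W W Y f u = f \<and> Comp K_A W W Y f u' = f"
    using Comp_Id_right[OF W(2) XY(1) W(3)] Comp_Id_right[OF W(2) XY(2) W(4)] by auto
  then show ?thesis
    using r unfolding roof_rel_def W(1) by (auto intro!: bexI[of _ "(W, s, f)"])
qed

theorem corollary1p2:
  shows "\<not> (\<exists>(s :: 'u::universe) b. bij_betw b (elts s)
           (Hom (D_A :: ('u chain_complex, _) cat)
             (in_degree_zero trivial_Z) (Susp K_A (in_degree_zero trivial_Z))))"
proof
  let ?R = "roofs K_A acyclic_complexes Z0 (suspension Z0) :: ('u chain_complex \<times> _) set"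
  let ?r = "roof_rel K_A acyclic_complexes Z0 (suspension Z0) :: ('u chain_complex \<times> _) rel"
  let ?F = "\<lambda>i :: 'u. ?r `` {ext.extension_roof i}"
  have Hom: "Hom (D_A :: ('u chain_complex, _) cat) Z0 (Susp K_A Z0) = ?R // ?r"
    by (simp add: D_A_def verdier_quotient_def)
  assume "\<exists>(s :: 'u) b. bij_betw b (elts s) (Hom (D_A :: ('u chain_complex, _) cat) Z0 (Susp K_A Z0))"
  then obtain s :: 'u and b where b: "bij_betw b (elts s) (?R // ?r)" unfolding Hom by blast
  have "inj_on ?F ordinals"
  proof (rule inj_onI)
    fix i j :: 'u assume "i \<in> ordinals" and eq: "?F i = ?F j"
    moreover have Z0: "(Z0 :: 'u chain_complex) \<in> chain_complexes"
      by (rule in_degree_zero_complex[OF trivial_Z_rmodule])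
    have "(ext.extension_roof j, ext.extension_roof j) \<in> ?r"
      by (rule roof_rel_refl[OF ext.extension_roof Z0 suspension_complex[OF Z0]])
    then have "(ext.extension_roof i, ext.extension_roof j) \<in> ?r" using eq by blast
    ultimately show "i = j" by (intro extension_roofs_distinct)
  qed
  moreover have "?F ` ordinals \<subseteq> ?R // ?r"
    using ext.extension_roof by (auto intro: quotientI)
  ultimately show False by (rule no_small_set_of_representatives[OF b])
qed

end
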